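(* Fix $r\in\mathbb R$ and suppose that the positive integers $n=n(N)$ satisfy, as $N\to\infty$, $$\frac nN=\frac12-\frac{r}{2\sqrt N}+o(N^{-1/2}).$$ Then for any fixed $d\in\mathbb Z_{\ge0}$ and any $x,y\in\mathbb Z_{\ge0}$, $$\lim_{N\to\infty}\mathfrak K^{(d)}_{n,\mathrm{Kr}}(N-x,N-y)=\mathbb K^{r}_{\mathrm{DHe}^+}(x,y).$$
   Context: Let $\mathfrak X=\{-N,\dots,N\}$ and let $w(x)=\binom{2N}{N+x}2^{-2N}$, $x\in\mathfrak X$, be the symmetric Krawtchouk weight. $P_m$ ($0\le m\le 2N$) are the monic orthogonal polynomials on $\mathfrak X$ with respect to $w$, with norms $h_m>0$, $h_m^2=\sum_xP_m(x)^2w(x)$, and $p_m(x)=P_m(x)\sqrt{w(x)}/h_m$. For $d\ge1$, $P_m^{(d)}$ ($0\le m\le2N-1$) are the monic orthogonal polynomials on $\mathfrak X$ with respect to $x^{2d}w(x)$, with norms $h^{(d)}_m>0$ in that weight, and $p^{(d)}_m(x)=P^{(d)}_m(x)\,x^d\sqrt{w(x)}/h^{(d)}_m$. Put $\eta(x)=1$ for $x\ne0$, $\eta(0)=1/\sqrt2$. For $x,y\in\mathfrak X$, $$\mathfrak K^{(0)}_{n,\mathrm{Kr}}(x,y)=2\eta(x)\eta(y)\sum_{\ell=0}^{n-1}p_{2\ell}(x)p_{2\ell}(y),\qquad \mathfrak K^{(d)}_{n,\mathrm{Kr}}(x,y)=2\sum_{\ell=0}^{n-1}p^{(d)}_{2\ell}(x)p^{(d)}_{2\ell}(y)\quad(d\ge1).$$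 $H_m$ is the (physicists') Hermite polynomial of degree $m$ with leading coefficient $2^m$ and $\int_{\mathbb R}H_x(t)H_y(t)e^{-t^2}dt=\sqrt\pi\,2^xx!\,\delta_{xy}$. The discrete Hermite kernel is $$\mathbb K^r_{\mathrm{DHe}^+}(x,y)=(\pi2^{x+y}x!\,y!)^{-1/2}\int_r^{+\infty}H_x(t)H_y(t)e^{-t^2}dt,\qquad x,y\in\mathbb Z_{\ge0}.$$ *)

theory Defs
  imports
    "HOL-Probability.Probability"
    "HOL-Computational_Algebra.Polynomial"
    "HOL-Library.Landau_Symbols"
begin

section \<open>Monic orthogonal polynomials on a finite set\<close>

definition is_monic_orth_poly :: "int set \<Rightarrow> (int \<Rightarrow> real) \<Rightarrow> nat \<Rightarrow> real poly \<Rightarrow> bool" where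
  "is_monic_orth_poly A v m p \<longleftrightarrow>
     degree p = m \<and> lead_coeff p = 1 \<and>
     (\<forall>q. degree q < m \<longrightarrow> (\<Sum>x\<in>A. poly p (of_int x) * poly q (of_int x) * v x) = 0)"

text \<open>
  The description determines a polynomial exactly when \<open>m\<close> is smaller than the number of points
  of \<open>A\<close> at which the (nonnegative) weight \<open>v\<close> does not vanish, see \<open>monic_orth_poly_ex1\<close> below;
  outside this range the value is irrelevant.
\<close>

definition monic_orth_poly :: "int set \<Rightarrow> (int \<Rightarrow> real) \<Rightarrow> nat \<Rightarrow> real poly" where
  "monic_orth_poly A v m = (THE p. is_monic_orth_poly A v m p)"

lemma monic_orth_poly_unique:
  assumes fin: "finite A" and nonneg: "\<And>x. x \<in> A \<Longrightarrow> v x \<ge> 0"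
    and m: "m \<le> card {x \<in> A. v x \<noteq> 0}"
    and p: "is_monic_orth_poly A v m p" and p': "is_monic_orth_poly A v m p'"
  shows "p = p'"
proof (rule ccontr)
  assume ne: "p \<noteq> p'"
  define q where "q = p - p'"
  have q0: "q \<noteq> 0" using ne by (simp add: q_def)
  have dp: "degree p = m" "lead_coeff p = 1" "degree p' = m" "lead_coeff p' = 1"
    using p p' by (auto simp: is_monic_orth_poly_def)
  have dq: "degree q < m"
  proof -
    have "degree q \<le> m" using dp by (simp add: q_def degree_diff_le)
    moreover have "coeff q m = 0" using dp by (simp add: q_def)
    ultimately show ?thesis using q0
      by (metis leading_coeff_0_iff le_neq_implies_less)
  qed
  have "(\<Sum>x\<in>A. poly q (of_int x) * poly q (of_int x) * v x) = 0"
  proof -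
    have "(\<Sum>x\<in>A. poly p (of_int x) * poly q (of_int x) * v x) = 0"
      "(\<Sum>x\<in>A. poly p' (of_int x) * poly q (of_int x) * v x) = 0"
      using p p' dq by (auto simp: is_monic_orth_poly_def)
    hence "(\<Sum>x\<in>A. poly p (of_int x) * poly q (of_int x) * v x
             - poly p' (of_int x) * poly q (of_int x) * v x) = 0"
      by (simp add: sum_subtractf)
    thus ?thesis by (simp add: q_def algebra_simps)
  qed
  hence "\<forall>x\<in>A. poly q (of_int x) * poly q (of_int x) * v x = 0"
    using fin nonneg by (subst (asm) sum_nonneg_eq_0_iff) auto
  hence "(of_int ` {x \<in> A. v x \<noteq> 0} :: real set) \<subseteq> {x. poly q x = 0}" by auto
  hence "card (of_int ` {x \<in> A. v x \<noteq> 0} :: real set) \<le> card {x. poly q x = 0}"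
    by (intro card_mono poly_roots_finite q0)
  moreover have "card (of_int ` {x \<in> A. v x \<noteq> 0} :: real set) = card {x \<in> A. v x \<noteq> 0}"
    by (rule card_image) (simp add: inj_on_def)
  moreover have "card {x. poly q x = 0} \<le> degree q" using card_poly_roots_bound[OF q0] .
  ultimately show False using m dq by linarith
qed

lemma monic_orth_poly_exists:
  assumes fin: "finite A" and nonneg: "\<And>x. x \<in> A \<Longrightarrow> v x \<ge> 0"
    and m: "m \<le> card {x \<in> A. v x \<noteq> 0}"
  shows "\<exists>p. is_monic_orth_poly A v m p"
  using m
proof (induction m rule: less_induct)
  case (less m)
  define ip where "ip p q = (\<Sum>x\<in>A. poly p (of_int x) * poly q (of_int x) * v x)"
    for p q :: "real poly"
  have ip_diff: "ip (p - p') q = ip p q - ip p' q" for p p' q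
    by (simp add: ip_def algebra_simps sum_subtractf)
  have ip_sum: "ip (\<Sum>k\<in>I. smult (c k) (F k)) q = (\<Sum>k\<in>I. c k * ip (F k) q)"
    for I :: "nat set" and c F q
    unfolding ip_def poly_sum sum_distrib_left sum_distrib_right poly_smult
    by (subst sum.swap) (simp add: mult_ac)
  have ip_comm: "ip p q = ip q p" for p q by (simp add: ip_def mult_ac)
  have "\<forall>k<m. \<exists>p. is_monic_orth_poly A v k p" using less by auto
  then obtain Q where Q: "\<And>k. k < m \<Longrightarrow> is_monic_orth_poly A v k (Q k)" by metis
  have dQ: "degree (Q k) = k" "lead_coeff (Q k) = 1" if "k < m" for k
    using Q[OF that] by (auto simp: is_monic_orth_poly_def)
  have oQ: "ip (Q k) q = 0" if "k < m" "degree q < k" for k q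
    using Q[OF that(1)] that(2) by (auto simp: is_monic_orth_poly_def ip_def)
  have oQ': "ip (Q k) (Q l) = 0" if "k < m" "l < m" "k \<noteq> l" for k l
    using that oQ[of k "Q l"] oQ[of l "Q k"] dQ ip_comm[of "Q k" "Q l"]
    by (cases "k < l") auto
  have nz: "ip (Q k) (Q k) \<noteq> 0" if "k < m" for k
  proof
    assume "ip (Q k) (Q k) = 0"
    hence "\<forall>x\<in>A. poly (Q k) (of_int x) * poly (Q k) (of_int x) * v x = 0"
      unfolding ip_def using fin nonneg by (subst (asm) sum_nonneg_eq_0_iff) auto
    hence "(of_int ` {x \<in> A. v x \<noteq> 0} :: real set) \<subseteq> {x. poly (Q k) x = 0}" by auto
    moreover have q0: "Q k \<noteq> 0" using dQ[OF that] by auto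
    ultimately have "card (of_int ` {x \<in> A. v x \<noteq> 0} :: real set) \<le> card {x. poly (Q k) x = 0}"
      by (intro card_mono poly_roots_finite)
    moreover have "card (of_int ` {x \<in> A. v x \<noteq> 0} :: real set) = card {x \<in> A. v x \<noteq> 0}"
      by (rule card_image) (simp add: inj_on_def)
    moreover have "card {x. poly (Q k) x = 0} \<le> k" using card_poly_roots_bound[OF q0] dQ that by simp
    ultimately show False using less.prems that by linarith
  qed
  define c where "c k = ip (monom 1 m) (Q k) / ip (Q k) (Q k)" for k
  define S where "S = (\<Sum>k<m. smult (c k) (Q k))"
  define P where "P = monom 1 m - S"
  have coeffS: "coeff S i = 0" if "i \<ge> m" for i
    unfolding S_def coeff_sum using that dQ by (intro sum.neutral) (auto simp: coeff_eq_0)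
  have cP: "coeff P m = 1" by (simp add: P_def coeffS)
  have dP: "degree P = m"
  proof (rule antisym)
    show "degree P \<le> m" by (rule degree_le) (auto simp: P_def coeffS)
    show "m \<le> degree P" using cP by (intro le_degree) simp
  qed
  have PQ: "ip P (Q j) = 0" if "j < m" for j
  proof -
    have "ip S (Q j) = (\<Sum>k<m. c k * ip (Q k) (Q j))" unfolding S_def by (rule ip_sum)
    also have "\<dots> = (\<Sum>k<m. if k = j then c j * ip (Q j) (Q j) else 0)"
      using that by (intro sum.cong) (auto simp: oQ')
    also have "\<dots> = ip (monom 1 m) (Q j)" using that nz[OF that] by (simp add: c_def)
    finally show ?thesis by (simp add: P_def ip_diff)
  qed
  have "ip P q = 0" if "degree q < m" for q
    using that
  proof (induction "degree q" arbitrary: q rule: less_induct)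
    case (less q)
    define d where "d = degree q"
    define q' where "q' = q - smult (lead_coeff q) (Q d)"
    have dm: "d < m" using less by (simp add: d_def)
    have eq: "ip P q = ip P q' + lead_coeff q * ip P (Q d)"
      by (simp add: ip_def q'_def algebra_simps sum_distrib_left sum_subtractf sum.distrib)
    show ?case
    proof (cases "q' = 0")
      case True
      hence "ip P q' = 0" by (simp add: ip_def)
      thus ?thesis using eq PQ[OF dm] by simp
    next
      case False
      have "coeff q' d = 0" using dQ[OF dm] by (simp add: q'_def d_def)
      moreover have "degree q' \<le> d" unfolding q'_def
        using dQ[OF dm] by (intro degree_diff_le) (auto simp: d_def)
      ultimately have "degree q' < d" using False
        by (metis leading_coeff_0_iff le_neq_implies_less)
      hence "ip P q' = 0" using less dm by (intro less(1)) (auto simp: d_def)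
      thus ?thesis using eq PQ[OF dm] by simp
    qed
  qed
  hence "is_monic_orth_poly A v m P" using dP cP by (simp add: is_monic_orth_poly_def ip_def)
  thus ?case by blast
qed

lemma monic_orth_poly_ex1:
  assumes "finite A" and "\<And>x. x \<in> A \<Longrightarrow> v x \<ge> 0" and "m < card {x \<in> A. v x \<noteq> 0}"
  shows "\<exists>!p. is_monic_orth_poly A v m p"
  using monic_orth_poly_exists[of A v m] monic_orth_poly_unique[of A v m] assms by auto

lemma is_monic_orth_poly_monic_orth_poly:
  assumes "finite A" and "\<And>x. x \<in> A \<Longrightarrow> v x \<ge> 0" and "m < card {x \<in> A. v x \<noteq> 0}"
  shows "is_monic_orth_poly A v m (monic_orth_poly A v m)"
  unfolding monic_orth_poly_def by (rule theI') (rule monic_orth_poly_ex1[OF assms])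

section \<open>The symmetric Krawtchouk kernels\<close>

definition kr_space :: "nat \<Rightarrow> int set" where
  "kr_space N = {- int N .. int N}"

text \<open>Only the values at points of \<^term>\<open>kr_space N\<close> are meaningful (\<^const>\<open>nat\<close> truncates).\<close>

definition kr_weight :: "nat \<Rightarrow> int \<Rightarrow> real" where
  "kr_weight N x = real ((2 * N) choose nat (int N + x)) / 2 ^ (2 * N)"

text \<open>For \<open>d = 0\<close> the weight below is \<^term>\<open>kr_weight N\<close> itself (\<open>0 ^ 0 = 1\<close>), so that
  \<open>kr_poly 0\<close>, \<open>kr_norm 0\<close> and \<open>kr_fun 0\<close> are the undeformed \<open>P\<^sub>m\<close>, \<open>h\<^sub>m\<close> and \<open>p\<^sub>m\<close>.\<close>

definition kr_weight_d :: "nat \<Rightarrow> nat \<Rightarrow> int \<Rightarrow> real" where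
  "kr_weight_d d N x = of_int x ^ (2 * d) * kr_weight N x"

definition kr_poly :: "nat \<Rightarrow> nat \<Rightarrow> nat \<Rightarrow> real poly" where
  "kr_poly d N m = monic_orth_poly (kr_space N) (kr_weight_d d N) m"

definition kr_norm :: "nat \<Rightarrow> nat \<Rightarrow> nat \<Rightarrow> real" where
  "kr_norm d N m = sqrt (\<Sum>x\<in>kr_space N. (poly (kr_poly d N m) (of_int x))\<^sup>2 * kr_weight_d d N x)"

definition kr_fun :: "nat \<Rightarrow> nat \<Rightarrow> nat \<Rightarrow> int \<Rightarrow> real" where
  "kr_fun d N m x =
     poly (kr_poly d N m) (of_int x) * of_int x ^ d * sqrt (kr_weight N x) / kr_norm d N m"

definition eta :: "int \<Rightarrow> real" where
  "eta x = (if x = 0 then 1 / sqrt 2 else 1)"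

definition kr_kernel :: "nat \<Rightarrow> nat \<Rightarrow> nat \<Rightarrow> int \<Rightarrow> int \<Rightarrow> real" where
  "kr_kernel d N n x y =
     (if d = 0
      then 2 * eta x * eta y * (\<Sum>l<n. kr_fun 0 N (2 * l) x * kr_fun 0 N (2 * l) y)
      else 2 * (\<Sum>l<n. kr_fun d N (2 * l) x * kr_fun d N (2 * l) y))"

lemma card_kr_support:
  "card {x \<in> kr_space N. kr_weight_d d N x \<noteq> 0} = (if d = 0 then 2 * N + 1 else 2 * N)"
proof -
  have "{x \<in> kr_space N. kr_weight_d d N x \<noteq> 0} = kr_space N - (if d = 0 then {} else {0})"
    by (auto simp: kr_space_def kr_weight_d_def kr_weight_def nat_le_iff)
  thus ?thesis by (auto simp: kr_space_def)
qed

lemma is_monic_orth_poly_kr_poly: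
  assumes "if d = 0 then m \<le> 2 * N else m < 2 * N"
  shows "is_monic_orth_poly (kr_space N) (kr_weight_d d N) m (kr_poly d N m)"
  unfolding kr_poly_def
proof (rule is_monic_orth_poly_monic_orth_poly)
  show "m < card {x \<in> kr_space N. kr_weight_d d N x \<noteq> 0}"
    using assms unfolding card_kr_support by (auto split: if_splits)
qed (auto simp: kr_space_def kr_weight_d_def kr_weight_def)

section \<open>Hermite polynomials and the discrete Hermite kernel\<close>

definition is_hermite_family :: "(nat \<Rightarrow> real poly) \<Rightarrow> bool" where
  "is_hermite_family H \<longleftrightarrow>
     (\<forall>m. degree (H m) = m \<and> lead_coeff (H m) = 2 ^ m) \<and>
     (\<forall>x y. (LINT t|lborel. poly (H x) t * poly (H y) t * exp (- t\<^sup>2)) =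
              (if x = y then sqrt pi * 2 ^ x * fact x else 0))"

text \<open>Existence and uniqueness are shown in \<open>hermite_family_ex1\<close> below.\<close>

definition hermite :: "nat \<Rightarrow> real poly" where
  "hermite = (THE H. is_hermite_family H)"

definition dHe_kernel :: "real \<Rightarrow> nat \<Rightarrow> nat \<Rightarrow> real" where
  "dHe_kernel r x y =
     (pi * 2 ^ (x + y) * fact x * fact y) powr (- 1 / 2) *
     (LINT t:{r..}|lborel. poly (hermite x) t * poly (hermite y) t * exp (- t\<^sup>2))"

definition gauss_int :: "real poly \<Rightarrow> real" where
  "gauss_int p = (LINT t|lborel. poly p t * exp (- t\<^sup>2))"

lemma has_bochner_integral_gauss_monom:
  "has_bochner_integral lborel (\<lambda>t::real. exp (- t\<^sup>2) * t ^ k)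
     (if even k then sqrt pi * (fact k / (2 ^ k * fact (k div 2))) else 0)"
proof (cases "even k")
  case True
  then obtain j where k: "k = 2 * j" by (auto elim: evenE)
  show ?thesis unfolding k
    using has_bochner_integral_even_function[OF gaussian_moment_even_pos[where k=j]] by simp
next
  case False
  then obtain j where k: "k = 2 * j + 1" by (auto elim: oddE)
  show ?thesis unfolding k
    using has_bochner_integral_odd_function[OF gaussian_moment_odd_pos[where k=j]] by simp
qed

lemma integrable_gauss_poly: "integrable lborel (\<lambda>t::real. poly p t * exp (- t\<^sup>2))"
proof -
  have "integrable lborel (\<lambda>t::real. \<Sum>i\<le>degree p. coeff p i * (exp (- t\<^sup>2) * t ^ i))"
    by (intro Bochner_Integration.integrable_sum integrable_mult_right
          has_bochner_integral_gauss_monom[THEN integrable.intros])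
  moreover have "(\<lambda>t::real. \<Sum>i\<le>degree p. coeff p i * (exp (- t\<^sup>2) * t ^ i)) =
      (\<lambda>t. poly p t * exp (- t\<^sup>2))"
    by (simp only: poly_altdef sum_distrib_right) (simp add: mult_ac)
  ultimately show ?thesis by simp
qed

lemma gauss_int_add: "gauss_int (p + q) = gauss_int p + gauss_int q"
  by (simp add: gauss_int_def ring_distribs integrable_gauss_poly)

lemma gauss_int_diff: "gauss_int (p - q) = gauss_int p - gauss_int q"
  by (simp add: gauss_int_def ring_distribs integrable_gauss_poly)

lemma gauss_int_smult: "gauss_int (smult c p) = c * gauss_int p"
  by (simp add: gauss_int_def mult.assoc)

lemma gauss_int_0 [simp]: "gauss_int 0 = 0"
  by (simp add: gauss_int_def)

lemma gauss_int_sum: "gauss_int (\<Sum>i\<in>I. f i) = (\<Sum>i\<in>I. gauss_int (f i))"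
  by (induction I rule: infinite_finite_induct) (auto simp: gauss_int_add)

lemma gauss_int_monom:
  "gauss_int (monom c k) =
     c * (if even k then sqrt pi * (fact k / (2 ^ k * fact (k div 2))) else 0)"
proof -
  have "gauss_int (monom c k) = (LINT t|lborel. c * (exp (- t\<^sup>2) * t ^ k))"
    by (simp add: gauss_int_def poly_monom mult_ac)
  thus ?thesis
    using has_bochner_integral_gauss_monom[of k, THEN has_bochner_integral_integral_eq]
    by simp
qed

lemma gauss_int_pos: assumes "p \<noteq> 0" shows "gauss_int (p * p) > 0"
proof -
  have nn: "gauss_int (p * p) \<ge> 0"
    unfolding gauss_int_def by (intro Bochner_Integration.integral_nonneg) auto
  moreover have "gauss_int (p * p) \<noteq> 0"
  proof
    assume "gauss_int (p * p) = 0"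
    hence "AE t in lborel. poly (p * p) t * exp (- t\<^sup>2) = 0"
      unfolding gauss_int_def
      by (subst (asm) integral_nonneg_eq_0_iff_AE[OF integrable_gauss_poly]) simp_all
    hence "AE t in lborel. poly p t = 0" by simp
    moreover have "AE t in lborel. t \<notin> {t. poly p t = 0}"
      by (intro AE_not_in finite_imp_null_set_lborel poly_roots_finite assms)
    ultimately have "AE t in (lborel :: real measure). False" by eventually_elim simp
    hence "(UNIV :: real set) \<in> null_sets lborel"
      by (subst (asm) AE_iff_null) auto
    thus False by (simp add: null_sets_def)
  qed
  ultimately show ?thesis by linarith
qed

lemma gauss_int_by_parts: "gauss_int (pderiv p) = gauss_int ([:0, 2:] * p)"
proof -
  have *: "gauss_int (pderiv (monom c k)) = gauss_int ([:0, 2:] * monom c k)" for c k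
  proof -
    have m: "[:0, 2:] * monom c k = monom (2 * c) (Suc k)"
      by (simp add: monom_Suc smult_monom)
    show ?thesis unfolding m pderiv_monom gauss_int_monom
    proof (cases k)
      case (Suc j)
      show "of_nat k * c *
          (if even (k - 1) then sqrt pi * (fact (k - 1) / (2 ^ (k - 1) * fact ((k - 1) div 2))) else 0) =
        2 * c *
          (if even (Suc k) then sqrt pi * (fact (Suc k) / (2 ^ Suc k * fact (Suc k div 2))) else 0)"
      proof (cases "even j")
        case True
        then obtain i where "j = 2 * i" by (auto elim: evenE)
        thus ?thesis unfolding Suc by (simp add: divide_simps) (simp add: algebra_simps)?
      qed (simp add: Suc)
    qed auto
  qed
  have p: "p = (\<Sum>i\<le>degree p. monom (coeff p i) i)" by (rule poly_as_sum_of_monoms[symmetric])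
  have "gauss_int (pderiv p) = (\<Sum>i\<le>degree p. gauss_int (pderiv (monom (coeff p i) i)))"
    by (subst p) (simp only: higher_pderiv_sum[of 1, simplified] gauss_int_sum)
  also have "\<dots> = (\<Sum>i\<le>degree p. gauss_int ([:0, 2:] * monom (coeff p i) i))"
    by (simp only: *)
  also have "\<dots> = gauss_int ([:0, 2:] * p)"
    by (subst (3) p) (simp only: sum_distrib_left gauss_int_sum)
  finally show ?thesis .
qed

fun hermite_rec :: "nat \<Rightarrow> real poly" where
  "hermite_rec 0 = 1"
| "hermite_rec (Suc m) = [:0, 2:] * hermite_rec m - pderiv (hermite_rec m)"

lemma degree_hermite_rec: "degree (hermite_rec m) = m \<and> lead_coeff (hermite_rec m) = 2 ^ m"
proof (induction m)
  case (Suc m)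
  have ne: "hermite_rec m \<noteq> 0" using Suc by auto
  have d1: "degree ([:0, 2:] * hermite_rec m) = Suc m" using Suc ne
    by (subst degree_mult_eq) auto
  have l1: "lead_coeff ([:0, 2:] * hermite_rec m) = 2 ^ Suc m" using Suc
    by (subst lead_coeff_mult) auto
  have d2: "degree (pderiv (hermite_rec m)) < Suc m" using Suc by (simp add: degree_pderiv)
  have "coeff (hermite_rec (Suc m)) (Suc m) = 2 ^ Suc m"
    using l1 d2 unfolding d1 by (simp add: coeff_eq_0 del: mult_pCons_left)
  moreover have "degree (hermite_rec (Suc m)) \<le> Suc m"
    unfolding hermite_rec.simps using d1 d2 by (intro degree_diff_le) auto
  ultimately show ?case
    by (metis le_antisym le_degree power_not_zero zero_neq_numeral)
qed simp

lemma gauss_int_hermite_rec: "gauss_int (q * hermite_rec m) = gauss_int ((pderiv ^^ m) q)"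
proof (induction m arbitrary: q)
  case (Suc m)
  have "gauss_int (q * hermite_rec (Suc m)) =
      gauss_int ([:0, 2:] * (q * hermite_rec m)) - gauss_int (q * pderiv (hermite_rec m))"
    by (simp only: gauss_int_diff[symmetric] hermite_rec.simps) (simp only: algebra_simps)
  also have "\<dots> = gauss_int (pderiv q * hermite_rec m)"
    by (simp only: gauss_int_by_parts[symmetric] pderiv_mult gauss_int_add) (simp add: mult_ac)
  finally show ?case using Suc[of "pderiv q"] by (simp add: funpow_swap1)
qed simp

lemma higher_pderiv_degree:
  "(pderiv ^^ degree q) q = [:fact (degree q) * lead_coeff q:]" for q :: "real poly"
proof (induction "degree q" arbitrary: q)
  case 0
  then obtain a where "q = [:a:]" by (metis degree_eq_zeroE)
  thus ?case by simp
next
  case (Suc m)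
  have dp: "degree (pderiv q) = m" using Suc(2) by (simp add: degree_pderiv)
  have "(pderiv ^^ degree q) q = (pderiv ^^ m) (pderiv q)"
    by (simp add: Suc(2)[symmetric] funpow_swap1)
  also have "\<dots> = [:fact m * coeff (pderiv q) m:]" using Suc(1)[of "pderiv q"] dp by simp
  also have "\<dots> = [:fact (degree q) * lead_coeff q:]"
    by (simp add: coeff_pderiv Suc(2)[symmetric])
  finally show ?case .
qed

lemma higher_pderiv_eq_0: "degree q < m \<Longrightarrow> (pderiv ^^ m) q = 0" for q :: "real poly"
proof -
  assume a: "degree q < m"
  have "(pderiv ^^ Suc (degree q)) q = 0" by (simp add: higher_pderiv_degree)
  moreover have "(pderiv ^^ k) (0 :: real poly) = 0" for k by (induction k) auto
  moreover have "m = (m - Suc (degree q)) + Suc (degree q)" using a by simp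
  ultimately show ?thesis by (metis comp_apply funpow_add)
qed

lemma gauss_int_one: "gauss_int [:c:] = c * sqrt pi"
  using gauss_int_monom[of c 0] by (simp add: monom_0)

lemma is_hermite_family_hermite_rec: "is_hermite_family hermite_rec"
proof -
  have lt: "gauss_int (hermite_rec x * hermite_rec y) = 0" if "x < y" for x y
    using that degree_hermite_rec[of x]
    by (simp add: gauss_int_hermite_rec higher_pderiv_eq_0)
  have eq: "gauss_int (hermite_rec x * hermite_rec x) = sqrt pi * 2 ^ x * fact x" for x
    using conjunct2[OF degree_hermite_rec[of x]] higher_pderiv_degree[of "hermite_rec x"]
    by (simp add: gauss_int_hermite_rec gauss_int_one degree_hermite_rec)
  have "gauss_int (hermite_rec x * hermite_rec y) =
      (if x = y then sqrt pi * 2 ^ x * fact x else 0)" for x y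
    using lt[of x y] lt[of y x] eq[of x] by (cases x y rule: linorder_cases) (auto simp: mult.commute)
  thus ?thesis unfolding is_hermite_family_def gauss_int_def poly_mult
    using degree_hermite_rec by blast
qed

lemma is_hermite_family_unique:
  assumes H: "is_hermite_family H"
  shows "H = hermite_rec"
proof
  fix m
  have dH: "degree (H k) = k" "lead_coeff (H k) = 2 ^ k" for k
    using H unfolding is_hermite_family_def by blast+
  have oH: "gauss_int (H x * H y) = 0" if "x \<noteq> y" for x y
    using H that by (auto simp: is_hermite_family_def gauss_int_def)
  have orth: "gauss_int (H m * q) = 0" if "degree q < m" for q m
    using that
  proof (induction "degree q" arbitrary: q rule: less_induct)
    case (less q)
    define d where "d = degree q"
    define c where "c = lead_coeff q / 2 ^ d"
    define q' where "q' = q - smult c (H d)"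
    have eq: "gauss_int (H m * q) = gauss_int (H m * q') + c * gauss_int (H m * H d)"
      unfolding gauss_int_smult[symmetric] gauss_int_add[symmetric]
      by (simp add: q'_def algebra_simps)
    have "gauss_int (H m * H d) = 0" using less by (intro oH) (auto simp: d_def)
    moreover have "gauss_int (H m * q') = 0"
    proof (cases "q' = 0")
      case False
      have "coeff q' d = 0" using dH[of d] by (simp add: q'_def d_def c_def)
      moreover have "degree q' \<le> d" unfolding q'_def
        using dH[of d] by (intro degree_diff_le) (auto simp: d_def)
      ultimately have "degree q' < d" using False
        by (metis leading_coeff_0_iff le_neq_implies_less)
      thus ?thesis using less by (intro less(1)) (auto simp: d_def)
    qed simp
    ultimately show ?case using eq by simp
  qed
  have orth': "gauss_int (hermite_rec m * q) = 0" if "degree q < m" for q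
    using gauss_int_hermite_rec[of q m] higher_pderiv_eq_0[OF that] by (simp add: mult.commute)
  define q where "q = H m - hermite_rec m"
  show "H m = hermite_rec m"
  proof (rule ccontr)
    assume "H m \<noteq> hermite_rec m"
    hence q0: "q \<noteq> 0" by (simp add: q_def)
    have "degree q \<le> m" using dH degree_hermite_rec by (simp add: q_def degree_diff_le)
    moreover have "coeff q m = 0" using dH(2)[of m] conjunct2[OF degree_hermite_rec[of m]]
      by (simp add: dH(1) degree_hermite_rec q_def)
    ultimately have "degree q < m" using q0 by (metis leading_coeff_0_iff le_neq_implies_less)
    hence "gauss_int (H m * q - hermite_rec m * q) = 0"
      by (simp add: gauss_int_diff orth orth')
    hence "gauss_int (q * q) = 0" by (simp add: q_def left_diff_distrib)
    thus False using gauss_int_pos[OF q0] by simp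
  qed
qed

lemma hermite_family_ex1: "\<exists>!H. is_hermite_family H"
  using is_hermite_family_hermite_rec is_hermite_family_unique by blast

lemma is_hermite_family_hermite: "is_hermite_family hermite"
  unfolding hermite_def using hermite_family_ex1 by (rule theI')

lemma hermite_eq_hermite_rec: "hermite = hermite_rec"
  using is_hermite_family_hermite by (rule is_hermite_family_unique)

end

theory Submission
  imports Defs "HOL-Real_Asymp.Real_Asymp"
begin

text \<open>
  For \<open>d = 0\<close> everything is explicit. The binomial weight has the Krawtchouk polynomials as orthogonal
  polynomials (\<open>kr_poly_0_eq_kraw\<close>), and these are self-dual (\<open>kraw_self_dual\<close>): at a point at fixed
  distance \<open>x\<close> from the edge, the orthonormal function of degree \<open>m\<close> is the square root of the binomial
  probability of \<open>m\<close> times a constant multiple of a Krawtchouk polynomial of degree \<open>x\<close> in \<open>m\<close>. So the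
  kernel is the integral of a product of two polynomials of fixed degree over a half-line, against
  the binomial distribution conditioned to even values (\<open>kr_kernel_0_eq_integral\<close>). Under the scaling \<open>m - N = O(sqrt N)\<close> these
  polynomials tend to Hermite polynomials (\<open>scaled_kraw_tendsto_hermite\<close>), since their three-term
  recurrences converge. The distribution tends to the normal law with density \<open>exp (- t\<^sup>2) / sqrt pi\<close>:
  its characteristic function is a sum of powers of a cosine and a sine, the latter of which vanishes in
  the limit. Exponential moments are bounded, so truncated moments converge too
  (\<open>even_binomial_truncated_moments\<close>), which gives the Hermite kernel on \<open>[r, \<infinity>)\<close> (\<open>kernel_0_limit\<close>).

  For \<open>d > 0\<close> the polynomials are not explicit, but the kernels can be compared. The even deformed
  functions span \<open>z ^ d\<close> times the even polynomials of degree below \<open>2 * n\<close>, times the square root of the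
  weight. Multiplication by \<open>(z / N) ^ d\<close> is a contraction of the lattice functions, is almost the identity
  near the edge, and maps the space of the undeformed kernel into that of the deformed kernel, and the
  latter into the space of the undeformed kernel with \<open>d\<close> more degrees. As the quadratic form of a
  reproducing kernel is a supremum over the unit ball of its space, this encloses the deformed form
  between two undeformed ones (\<open>kr_form_deform_lower\<close>, \<open>kr_form_deform_upper\<close>), both of which have the
  limit already found. Polarisation passes from forms to kernels.
\<close>

section \<open>Comparison of reproducing kernels\<close>
lemma sum_bilinear_quadratic:
  fixes p q :: "nat \<Rightarrow> real"
  shows "(\<Sum>l<n. (c1 * p l + c2 * q l)\<^sup>2) =
    c1\<^sup>2 * (\<Sum>l<n. p l * p l) + 2 * c1 * c2 * (\<Sum>l<n. p l * q l) + c2\<^sup>2 * (\<Sum>l<n. q l * q l)"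
  by (simp add: power2_eq_square algebra_simps sum.distrib sum_distrib_left)

lemma sum_square_orthonormal:
  fixes \<phi> :: "nat \<Rightarrow> int \<Rightarrow> real"
  assumes orth: "\<And>k l. k < n \<Longrightarrow> l < n \<Longrightarrow> (\<Sum>z\<in>Z. \<phi> k z * \<phi> l z) = (if k = l then 1 else 0)"
  shows "(\<Sum>z\<in>Z. (\<Sum>l<n. b l * \<phi> l z)\<^sup>2) = (\<Sum>l<n. (b l)\<^sup>2)"
proof -
  have "(\<Sum>z\<in>Z. (\<Sum>l<n. b l * \<phi> l z)\<^sup>2) = (\<Sum>z\<in>Z. \<Sum>k<n. \<Sum>l<n. b k * b l * (\<phi> k z * \<phi> l z))"
    by (simp add: power2_eq_square sum_product algebra_simps)
  also have "\<dots> = (\<Sum>k<n. \<Sum>l<n. b k * b l * (\<Sum>z\<in>Z. \<phi> k z * \<phi> l z))"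
    unfolding sum_distrib_left
    by (subst sum.swap, rule sum.cong[OF refl], subst sum.swap, rule refl)
  also have "\<dots> = (\<Sum>k<n. \<Sum>l<n. if k = l then b k * b l else 0)"
    by (intro sum.cong refl) (auto simp: orth)
  also have "\<dots> = (\<Sum>l<n. (b l)\<^sup>2)"
    by (simp add: power2_eq_square)
  finally show ?thesis .
qed

text \<open>
  The quadratic form of a reproducing kernel is a supremum: for a linear functional \<open>L\<close> on the span of
  an orthonormal system \<open>\<psi>\<close>, the sum of the squares \<open>(L \<psi>\<^sub>k)\<^sup>2\<close> is the largest value of \<open>(L g)\<^sup>2\<close> over unit
  vectors \<open>g\<close> of the span. Hence if multiplication by a contraction \<open>a\<close> maps one span into another, the
  form of the first kernel, at the functional \<open>L\<close> composed with the multiplication, is at most that of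
  the second. Here \<open>L\<close> is a combination of two point evaluations, which is all that polarisation needs.
\<close>
lemma kernel_form_mono:
  fixes \<phi> \<psi> :: "nat \<Rightarrow> int \<Rightarrow> real" and a :: "int \<Rightarrow> real"
  assumes fin: "finite Z" and xy: "x \<in> Z" "y \<in> Z"
    and orth\<phi>: "\<And>k l. k < n \<Longrightarrow> l < n \<Longrightarrow> (\<Sum>z\<in>Z. \<phi> k z * \<phi> l z) = (if k = l then 1 else 0)"
    and orth\<psi>: "\<And>k l. k < m \<Longrightarrow> l < m \<Longrightarrow> (\<Sum>z\<in>Z. \<psi> k z * \<psi> l z) = (if k = l then 1 else 0)"
    and a: "\<And>z. z \<in> Z \<Longrightarrow> \<bar>a z\<bar> \<le> 1"
    and span: "\<And>l. l < n \<Longrightarrow> \<exists>b. \<forall>z\<in>Z. a z * \<phi> l z = (\<Sum>k<m. b k * \<psi> k z)"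
  shows "(\<Sum>l<n. (c1 * a x * \<phi> l x + c2 * a y * \<phi> l y)\<^sup>2) \<le> (\<Sum>k<m. (c1 * \<psi> k x + c2 * \<psi> k y)\<^sup>2)"
proof -
  define u where "u l = c1 * a x * \<phi> l x + c2 * a y * \<phi> l y" for l
  define Q where "Q = (\<Sum>l<n. (u l)\<^sup>2)"
  define R where "R = (\<Sum>k<m. (c1 * \<psi> k x + c2 * \<psi> k y)\<^sup>2)"
  \<comment> \<open>the function in the span of the \<open>\<phi>\<^sub>l\<close> representing the functional
     \<open>g \<mapsto> c1 * a x * g x + c2 * a y * g y\<close>\<close>
  define f where "f z = (\<Sum>l<n. u l * \<phi> l z)" for z
  obtain b where b: "\<And>l z. l < n \<Longrightarrow> z \<in> Z \<Longrightarrow> a z * \<phi> l z = (\<Sum>k<m. b l k * \<psi> k z)"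
    using span by metis
  define B where "B k = (\<Sum>l<n. u l * b l k)" for k
  have af: "a z * f z = (\<Sum>k<m. B k * \<psi> k z)" if "z \<in> Z" for z
  proof -
    have "a z * f z = (\<Sum>l<n. u l * (\<Sum>k<m. b l k * \<psi> k z))"
      unfolding f_def sum_distrib_left
      by (intro sum.cong refl) (use b that in \<open>auto simp: sum_distrib_left[symmetric] mult.left_commute\<close>)
    also have "\<dots> = (\<Sum>k<m. B k * \<psi> k z)"
      unfolding B_def sum_distrib_left sum_distrib_right
      by (subst sum.swap) (simp add: mult_ac)
    finally show ?thesis .
  qed
  have Q0: "Q \<ge> 0" unfolding Q_def by (intro sum_nonneg) auto
  have R0: "R \<ge> 0" unfolding R_def by (intro sum_nonneg) auto
  have "Q = c1 * (a x * f x) + c2 * (a y * f y)"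
    unfolding Q_def f_def by (simp add: u_def power2_eq_square algebra_simps sum.distrib sum_distrib_left)
  also have "\<dots> = (\<Sum>k<m. B k * (c1 * \<psi> k x + c2 * \<psi> k y))"
    using xy by (simp add: af algebra_simps sum.distrib sum_distrib_left)
  finally have "Q\<^sup>2 \<le> (\<Sum>k<m. (B k)\<^sup>2) * R"
    unfolding R_def using Cauchy_Schwarz_ineq_sum by metis
  also have "(\<Sum>k<m. (B k)\<^sup>2) = (\<Sum>z\<in>Z. (a z * f z)\<^sup>2)"
    using sum_square_orthonormal[OF orth\<psi>, where b = B] by (simp add: af)
  also have "\<dots> \<le> (\<Sum>z\<in>Z. (f z)\<^sup>2)"
  proof (rule sum_mono)
    fix z assume "z \<in> Z"
    hence "\<bar>a z * f z\<bar> \<le> \<bar>f z\<bar>" using mult_right_mono[OF a, of z "\<bar>f z\<bar>"] by (simp add: abs_mult)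
    thus "(a z * f z)\<^sup>2 \<le> (f z)\<^sup>2" by (simp add: abs_le_square_iff)
  qed
  also have "(\<Sum>z\<in>Z. (f z)\<^sup>2) = Q"
    unfolding f_def Q_def by (rule sum_square_orthonormal[OF orth\<phi>])
  finally have "Q * Q \<le> Q * R" using R0 by (simp add: power2_eq_square mult_right_mono)
  hence "Q \<le> R" using Q0 R0 by (cases "Q = 0") auto
  thus ?thesis by (simp add: Q_def R_def u_def)
qed

section \<open>The even deformed Krawtchouk functions\<close>

text \<open>
  The weight is symmetric, so reflecting the argument of the polynomial of even degree gives again a
  monic orthogonal polynomial; by uniqueness the polynomial is even.
\<close>
lemma kr_poly_even:
  assumes "2 * l < 2 * N" "odd i"
  shows "coeff (kr_poly d N (2 * l)) i = 0"
proof -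
  define P where "P = kr_poly d N (2 * l)"
  define P' where "P' = pcompose P [:0, -1:]"
  have P: "is_monic_orth_poly (kr_space N) (kr_weight_d d N) (2 * l) P"
    unfolding P_def by (rule is_monic_orth_poly_kr_poly) (use assms in auto)
  have dP: "degree P = 2 * l" "lead_coeff P = 1" using P by (auto simp: is_monic_orth_poly_def)
  have w: "kr_weight_d d N (- z) = kr_weight_d d N z" if "z \<in> kr_space N" for z
  proof -
    have "(2 * N) choose nat (int N + z) = (2 * N) choose (2 * N - nat (int N + z))"
      using that by (intro binomial_symmetric) (auto simp: kr_space_def)
    also have "2 * N - nat (int N + z) = nat (int N + - z)"
      using that by (auto simp: kr_space_def nat_diff_distrib)
    finally show ?thesis by (simp add: kr_weight_d_def kr_weight_def)
  qed
  have refl: "bij_betw uminus (kr_space N) (kr_space N)"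
    by (rule bij_betwI[of _ _ _ uminus]) (auto simp: kr_space_def)
  have P': "is_monic_orth_poly (kr_space N) (kr_weight_d d N) (2 * l) P'"
    unfolding is_monic_orth_poly_def
  proof (intro conjI allI impI)
    show d: "degree P' = 2 * l" unfolding P'_def degree_pcompose using dP by simp
    show "lead_coeff P' = 1" unfolding d using dP by (simp add: P'_def coeff_pcompose_linear)
    fix q :: "real poly" assume q: "degree q < 2 * l"
    have "(\<Sum>z\<in>kr_space N. poly P' (of_int z) * poly q (of_int z) * kr_weight_d d N z) =
      (\<Sum>z\<in>kr_space N. poly P (of_int (- z)) * poly (pcompose q [:0, -1:]) (of_int (- z))
         * kr_weight_d d N (- z))"
      by (intro sum.cong refl) (auto simp: P'_def poly_pcompose w)
    also have "\<dots> = (\<Sum>z\<in>kr_space N. poly P (of_int z) * poly (pcompose q [:0, -1:]) (of_int z)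
         * kr_weight_d d N z)"
      by (rule sum.reindex_bij_betw[OF refl])
    also have "\<dots> = 0"
    proof -
      have "degree (pcompose q [:0, -1:]) < 2 * l" unfolding degree_pcompose using q by simp
      thus ?thesis using P unfolding is_monic_orth_poly_def by blast
    qed
    finally show "(\<Sum>z\<in>kr_space N. poly P' (of_int z) * poly q (of_int z) * kr_weight_d d N z) = 0" .
  qed
  have "P = P'"
  proof (rule monic_orth_poly_unique[OF _ _ _ P P'])
    show "2 * l \<le> card {z \<in> kr_space N. kr_weight_d d N z \<noteq> 0}"
      using assms unfolding card_kr_support by auto
  qed (auto simp: kr_space_def kr_weight_d_def kr_weight_def)
  hence "coeff P i = (-1) ^ i * coeff P i"
    by (metis P'_def coeff_pcompose_linear)
  thus ?thesis using \<open>odd i\<close> by (simp add: P_def)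
qed

text \<open>
  Peel off the leading coefficient: an even polynomial has no term of degree \<open>2 * m + 1\<close>, so that a
  single multiple of the polynomial of degree \<open>2 * m\<close> lowers the bound on the degree by two.
\<close>
lemma even_poly_expansion:
  assumes "2 * m \<le> 2 * N" "\<And>i. odd i \<Longrightarrow> coeff q i = 0" "\<And>i. i \<ge> 2 * m \<Longrightarrow> coeff q i = 0"
  shows "\<exists>b. q = (\<Sum>l<m. smult (b l) (kr_poly d N (2 * l)))"
  using assms
proof (induction m arbitrary: q)
  case 0
  thus ?case by (auto simp: poly_eq_iff)
next
  case (Suc m)
  define P where "P = kr_poly d N (2 * m)"
  define q' where "q' = q - smult (coeff q (2 * m)) P"
  have P: "degree P = 2 * m" "lead_coeff P = 1"
  proof -
    have "if d = 0 then 2 * m \<le> 2 * N else 2 * m < 2 * N" using Suc.prems(1) by auto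
    from is_monic_orth_poly_kr_poly[OF this] show "degree P = 2 * m" "lead_coeff P = 1"
      unfolding is_monic_orth_poly_def P_def by auto
  qed
  have "\<exists>b. q' = (\<Sum>l<m. smult (b l) (kr_poly d N (2 * l)))"
  proof (rule Suc.IH)
    show "coeff q' i = 0" if "odd i" for i
      using that Suc.prems kr_poly_even[of m N i d] by (simp add: q'_def P_def)
    show "coeff q' i = 0" if "i \<ge> 2 * m" for i
    proof (cases "i = 2 * m")
      case True
      thus ?thesis using P by (simp add: q'_def)
    next
      case False
      hence "i > 2 * m" using that by simp
      hence "coeff q i = 0"
        using Suc.prems(2)[of i] Suc.prems(3)[of i] by (cases "i = 2 * m + 1") auto
      thus ?thesis using P \<open>i > 2 * m\<close> by (simp add: q'_def coeff_eq_0)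
    qed
  qed (use Suc.prems in auto)
  then obtain b where b: "q' = (\<Sum>l<m. smult (b l) (kr_poly d N (2 * l)))" by blast
  have "q = (\<Sum>l<Suc m. smult ((b(m := coeff q (2 * m))) l) (kr_poly d N (2 * l)))"
    using b by (simp add: q'_def P_def algebra_simps)
  thus ?case by blast
qed

lemma kr_norm_pos:
  assumes "if d = 0 then m \<le> 2 * N else m < 2 * N"
  shows "kr_norm d N m > 0"
proof -
  define P where "P = kr_poly d N m"
  let ?s = "\<Sum>z\<in>kr_space N. (poly P (of_int z))\<^sup>2 * kr_weight_d d N z"
  have w0: "kr_weight_d d N z \<ge> 0" for z by (simp add: kr_weight_d_def kr_weight_def)
  have P: "degree P = m" "lead_coeff P = 1"
    using is_monic_orth_poly_kr_poly[OF assms] by (auto simp: is_monic_orth_poly_def P_def)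
  have "?s \<noteq> 0"
  proof
    assume "?s = 0"
    hence "\<forall>z\<in>kr_space N. (poly P (of_int z))\<^sup>2 * kr_weight_d d N z = 0"
      using w0 by (subst (asm) sum_nonneg_eq_0_iff) (auto simp: kr_space_def)
    hence "(of_int ` {z \<in> kr_space N. kr_weight_d d N z \<noteq> 0} :: real set) \<subseteq> {z. poly P z = 0}"
      by auto
    moreover have "P \<noteq> 0" using P by auto
    ultimately have "card (of_int ` {z \<in> kr_space N. kr_weight_d d N z \<noteq> 0} :: real set)
        \<le> card {z. poly P z = 0}"
      by (intro card_mono poly_roots_finite)
    also have "\<dots> \<le> m" using card_poly_roots_bound[OF \<open>P \<noteq> 0\<close>] P by simp
    also have "card (of_int ` {z \<in> kr_space N. kr_weight_d d N z \<noteq> 0} :: real set)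
        = (if d = 0 then 2 * N + 1 else 2 * N)"
      unfolding card_kr_support[symmetric] by (rule card_image) (simp add: inj_on_def)
    finally show False using assms by (auto split: if_splits)
  qed
  moreover have "?s \<ge> 0" using w0 by (intro sum_nonneg) auto
  ultimately show ?thesis by (simp add: kr_norm_def P_def)
qed

lemma kr_fun_orthonormal:
  assumes k: "if d = 0 then k \<le> 2 * N else k < 2 * N"
    and l: "if d = 0 then l \<le> 2 * N else l < 2 * N"
  shows "(\<Sum>z\<in>kr_space N. kr_fun d N k z * kr_fun d N l z) = (if k = l then 1 else 0)"
proof -
  let ?P = "\<lambda>k z. poly (kr_poly d N k) (of_int z)"
  let ?S = "\<lambda>k l. \<Sum>z\<in>kr_space N. ?P k z * ?P l z * kr_weight_d d N z"
  note Pk = is_monic_orth_poly_kr_poly[OF k] and Pl = is_monic_orth_poly_kr_poly[OF l]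
  have w: "kr_weight N z \<ge> 0" for z by (simp add: kr_weight_def)
  have "(\<Sum>z\<in>kr_space N. kr_fun d N k z * kr_fun d N l z) = ?S k l / (kr_norm d N k * kr_norm d N l)"
    unfolding sum_divide_distrib
    by (intro sum.cong refl)
      (simp add: kr_fun_def kr_weight_d_def w power_mult power2_eq_square power_mult_distrib mult_ac
        flip: power2_eq_square[of "sqrt _"])
  moreover have "?S k l = 0" if "k < l"
    using Pl Pk that by (auto simp: is_monic_orth_poly_def mult.commute)
  moreover have "?S k l = 0" if "l < k"
    using Pl Pk that by (auto simp: is_monic_orth_poly_def)
  moreover have "?S k k = kr_norm d N k * kr_norm d N k"
    unfolding kr_norm_def
    by (simp add: power2_eq_square sum_nonneg kr_weight_d_def kr_weight_def power_mult)
  ultimately show ?thesis using kr_norm_pos[OF k] by (cases k l rule: linorder_cases) auto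
qed

lemma even_poly_in_kr_span:
  assumes m: "m \<le> N" and q: "\<And>i. odd i \<Longrightarrow> coeff q i = 0" "\<And>i. i \<ge> 2 * m \<Longrightarrow> coeff q i = 0"
  shows "\<exists>b. \<forall>z. poly q (of_int z) * of_int z ^ d * sqrt (kr_weight N z) =
           (\<Sum>l<m. b l * kr_fun d N (2 * l) z)"
proof -
  obtain b where b: "q = (\<Sum>l<m. smult (b l) (kr_poly d N (2 * l)))"
    using even_poly_expansion[of m N q d] m q by auto
  have "poly q (of_int z) * of_int z ^ d * sqrt (kr_weight N z) =
      (\<Sum>l<m. (b l * kr_norm d N (2 * l)) * kr_fun d N (2 * l) z)" for z
  proof -
    have "poly q (of_int z) * of_int z ^ d * sqrt (kr_weight N z) =
      (\<Sum>l<m. b l * (poly (kr_poly d N (2 * l)) (of_int z) * of_int z ^ d * sqrt (kr_weight N z)))"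
      by (simp add: b poly_sum sum_distrib_right mult.assoc)
    also have "\<dots> = (\<Sum>l<m. (b l * kr_norm d N (2 * l)) * kr_fun d N (2 * l) z)"
    proof (rule sum.cong[OF refl])
      fix l assume "l \<in> {..<m}"
      hence "kr_norm d N (2 * l) > 0" using m by (intro kr_norm_pos) auto
      thus "b l * (poly (kr_poly d N (2 * l)) (of_int z) * of_int z ^ d * sqrt (kr_weight N z)) =
        (b l * kr_norm d N (2 * l)) * kr_fun d N (2 * l) z"
        by (simp add: kr_fun_def)
    qed
    finally show ?thesis .
  qed
  thus ?thesis by (intro exI[of _ "\<lambda>l. b l * kr_norm d N (2 * l)"]) blast
qed

text \<open>
  Up to the factor two and the factors \<open>eta\<close>, this is the quadratic form of the kernel at the points \<open>x\<close>
  and \<open>y\<close>.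
\<close>
definition kr_form :: "nat \<Rightarrow> nat \<Rightarrow> nat \<Rightarrow> int \<Rightarrow> int \<Rightarrow> real \<Rightarrow> real \<Rightarrow> real" where
  "kr_form d N n x y c1 c2 = (\<Sum>l<n. (c1 * kr_fun d N (2 * l) x + c2 * kr_fun d N (2 * l) y)\<^sup>2)"

lemma finite_kr_space [simp]: "finite (kr_space N)"
  by (simp add: kr_space_def)

lemma abs_scaled_le_1:
  assumes "z \<in> kr_space N" shows "\<bar>(of_int z / real N) ^ d\<bar> \<le> 1"
proof -
  have "\<bar>of_int z\<bar> \<le> real N" using assms by (auto simp: kr_space_def)
  hence "\<bar>of_int z / real N\<bar> \<le> 1" by (cases "N = 0") auto
  thus ?thesis by (simp add: power_abs power_le_one)
qed

text \<open>
  Multiplication by \<open>(z / N) ^ d\<close> is a contraction on the lattice, and it maps the span of the first \<open>n\<close>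
  even undeformed functions into the span of the first \<open>n\<close> deformed ones, which carry the factor \<open>z ^ d\<close>
  by definition.
\<close>
lemma kr_form_deform_lower:
  assumes "n \<le> N" "x \<in> kr_space N" "y \<in> kr_space N"
  shows "kr_form 0 N n x y (c1 * (of_int x / real N) ^ d) (c2 * (of_int y / real N) ^ d)
    \<le> kr_form d N n x y c1 c2"
  unfolding kr_form_def
proof (rule kernel_form_mono[where Z = "kr_space N" and a = "\<lambda>z. (of_int z / real N) ^ d"])
  fix l assume l: "l < n"
  let ?q = "smult (1 / (real N ^ d * kr_norm 0 N (2 * l))) (kr_poly 0 N (2 * l))"
  have "degree (kr_poly 0 N (2 * l)) = 2 * l"
    using is_monic_orth_poly_kr_poly[of 0 "2 * l" N] l assms by (auto simp: is_monic_orth_poly_def)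
  hence "\<exists>b. \<forall>z. poly ?q (of_int z) * of_int z ^ d * sqrt (kr_weight N z) =
           (\<Sum>k<n. b k * kr_fun d N (2 * k) z)"
    using l assms by (intro even_poly_in_kr_span) (auto simp: kr_poly_even coeff_eq_0)
  moreover have "poly ?q (of_int z) * of_int z ^ d * sqrt (kr_weight N z) =
      (of_int z / real N) ^ d * kr_fun 0 N (2 * l) z" for z
    by (simp add: kr_fun_def power_divide)
  ultimately show "\<exists>b. \<forall>z\<in>kr_space N. (of_int z / real N) ^ d * kr_fun 0 N (2 * l) z =
           (\<Sum>k<n. b k * kr_fun d N (2 * k) z)"
    by auto
qed (use assms in \<open>auto simp: kr_fun_orthonormal abs_scaled_le_1 simp del: abs_divide power_abs\<close>)

text \<open>
  The same multiplication maps back: a deformed function acquires the factor \<open>z ^ (2 * d)\<close>, which is an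
  even polynomial whatever the parity of \<open>d\<close>, at the cost of \<open>d\<close> further even degrees.
\<close>
lemma kr_form_deform_upper:
  assumes "n + d \<le> N" "x \<in> kr_space N" "y \<in> kr_space N"
  shows "kr_form d N n x y (c1 * (of_int x / real N) ^ d) (c2 * (of_int y / real N) ^ d)
    \<le> kr_form 0 N (n + d) x y c1 c2"
  unfolding kr_form_def
proof (rule kernel_form_mono[where Z = "kr_space N" and a = "\<lambda>z. (of_int z / real N) ^ d"])
  fix l assume l: "l < n"
  let ?P = "kr_poly d N (2 * l)"
  let ?q = "smult (1 / (real N ^ d * kr_norm d N (2 * l))) (monom 1 (2 * d) * ?P)"
  have "degree ?P = 2 * l"
    using is_monic_orth_poly_kr_poly[of d "2 * l" N] l assms
    by (auto simp: is_monic_orth_poly_def split: if_splits)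
  hence "\<exists>b. \<forall>z. poly ?q (of_int z) * of_int z ^ 0 * sqrt (kr_weight N z) =
           (\<Sum>k<n + d. b k * kr_fun 0 N (2 * k) z)"
    using l assms
    by (intro even_poly_in_kr_span) (auto simp: coeff_monom_mult kr_poly_even coeff_eq_0)
  moreover have "poly ?q (of_int z) * of_int z ^ 0 * sqrt (kr_weight N z) =
      (of_int z / real N) ^ d * kr_fun d N (2 * l) z" for z
    by (simp add: kr_fun_def power_divide poly_monom power_add mult_2)
  ultimately show "\<exists>b. \<forall>z\<in>kr_space N. (of_int z / real N) ^ d * kr_fun d N (2 * l) z =
           (\<Sum>k<n + d. b k * kr_fun 0 N (2 * k) z)"
    by auto
qed (use assms in \<open>auto simp: kr_fun_orthonormal abs_scaled_le_1 simp del: abs_divide power_abs\<close>)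

section \<open>Krawtchouk polynomials and their self-duality\<close>

text \<open>
  The Krawtchouk polynomials on \<open>M + 1\<close> points in the centred variable \<open>z = M / 2 - j\<close>, normalised so
  that their values are the coefficients of \<open>(1 - u) ^ j * (1 + u) ^ (M - j)\<close>. By self-duality the same
  recurrence in the degree also governs their dependence on the lattice point.
\<close>
fun kraw :: "nat \<Rightarrow> nat \<Rightarrow> real poly" where
  "kraw M 0 = 1"
| "kraw M (Suc 0) = [:0, 2:]"
| "kraw M (Suc (Suc k)) =
     smult (1 / real (k + 2)) ([:0, 2:] * kraw M (Suc k) - smult (real M - real k) (kraw M k))"

lemma degree_kraw: "degree (kraw M k) = k \<and> lead_coeff (kraw M k) = 2 ^ k / fact k"
proof (induction k rule: less_induct)
  case (less k)
  consider "k = 0" | "k = 1" | l where "k = Suc (Suc l)" by (metis One_nat_def not0_implies_Suc)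
  thus ?case
  proof cases
    case 3
    have d: "degree (kraw M l) = l" "degree (kraw M (Suc l)) = Suc l"
      "coeff (kraw M (Suc l)) (Suc l) = 2 ^ Suc l / fact (Suc l)"
      using less.IH[of l] less.IH[of "Suc l"] 3 by auto
    have c: "coeff (kraw M k) (Suc i) =
        (2 * coeff (kraw M (Suc l)) i - (real M - real l) * coeff (kraw M l) (Suc i)) / real (l + 2)" for i
      unfolding 3 by (simp add: coeff_pCons)
    have lead: "coeff (kraw M k) k = 2 ^ k / fact k"
      unfolding c[of "Suc l", folded 3] using d by (simp add: coeff_eq_0 3 field_simps)
    have "degree (kraw M k) \<le> k"
    proof (rule degree_le, intro allI impI)
      fix i assume "i > k"
      then obtain j where "i = Suc j" "j > Suc l" using 3 by (cases i) auto
      thus "coeff (kraw M k) i = 0" using c[of j] d by (simp add: coeff_eq_0)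
    qed
    moreover have "k \<le> degree (kraw M k)" using lead by (intro le_degree) simp
    ultimately show ?thesis using lead by simp
  qed auto
qed

lemma coeff_kraw_self: "coeff (kraw M k) k = 2 ^ k / fact k"
  using degree_kraw[of M k] by metis

lemma mult_pderiv_power: "p * pderiv (p ^ n) = of_nat n * (pderiv p * p ^ n)"
  for p :: "real poly"
  by (cases n) (auto simp: pderiv_power_Suc of_nat_poly algebra_simps simp del: power_Suc, simp add: algebra_simps)

text \<open>
  The generating polynomial \<open>F\<close> satisfies the differential equation
  \<open>(1 - u\<^sup>2) * F' = ((M - 2 * j) - M * u) * F\<close>, and comparing coefficients gives the recurrence.
\<close>
lemma kraw_gen_poly:
  assumes "j \<le> M"
  shows "coeff ([:1, -1:] ^ j * [:1, 1:] ^ (M - j)) k = poly (kraw M k) (real M / 2 - real j)"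
proof -
  define A B :: "real poly" where "A = [:1, -1:]" and "B = [:1, 1:]"
  define F where "F = A ^ j * B ^ (M - j)"
  have pd: "pderiv A = [:-1:]" "pderiv B = [:1:]" by (auto simp: A_def B_def pderiv_pCons)
  have "A * B * pderiv F = B * (B ^ (M - j) * (A * pderiv (A ^ j))) + A * (A ^ j * (B * pderiv (B ^ (M - j))))"
    unfolding F_def pderiv_mult by (simp add: algebra_simps)
  also have "\<dots> = (of_nat (M - j) * A - of_nat j * B) * F"
    unfolding mult_pderiv_power pd F_def by (simp add: algebra_simps)
  also have "of_nat (M - j) * A - of_nat j * B = [:real M - 2 * real j, - real M:]"
    using assms by (simp add: A_def B_def of_nat_poly of_nat_diff)
  also have "A * B = [:1, 0, -1:]" by (simp add: A_def B_def)
  finally have ode: "[:1, 0, -1:] * pderiv F = [:real M - 2 * real j, - real M:] * F" .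
  have c0: "coeff F 0 = 1"
    by (simp add: F_def A_def B_def coeff_mult coeff_0_power)
  have c1: "coeff F (Suc 0) = real M - 2 * real j"
    using arg_cong[OF ode, of "\<lambda>p. coeff p 0"] c0 by (simp add: coeff_pderiv)
  have rec: "real (k + 2) * coeff F (Suc (Suc k)) =
      (real M - 2 * real j) * coeff F (Suc k) - (real M - real k) * coeff F k" for k
    using arg_cong[OF ode, of "\<lambda>p. coeff p (Suc k)"]
    by (cases k) (auto simp: coeff_pderiv algebra_simps)
  have "coeff F k = poly (kraw M k) (real M / 2 - real j)"
  proof (induction k rule: induct_nat_012)
    case (ge2 k)
    have "coeff F (Suc (Suc k)) = 1 / real (k + 2) *
        ((real M - 2 * real j) * coeff F (Suc k) - (real M - real k) * coeff F k)"
      unfolding rec[symmetric] by simp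
    thus ?case using ge2 by (simp add: algebra_simps)
  qed (use c0 c1 in auto)
  thus ?thesis by (simp add: F_def A_def B_def)
qed

abbreviation kraw_val :: "nat \<Rightarrow> nat \<Rightarrow> nat \<Rightarrow> real" where
  "kraw_val M k j \<equiv> poly (kraw M k) (real M / 2 - real j)"

lemma kraw_generating_function:
  assumes "j \<le> M"
  shows "(1 - u) ^ j * (1 + u) ^ (M - j) = (\<Sum>k\<le>M. kraw_val M k j * u ^ k)"
proof -
  define F :: "real poly" where "F = [:1, -1:] ^ j * [:1, 1:] ^ (M - j)"
  have "degree F \<le> degree ([:1, -1::real:] ^ j) + degree ([:1, 1::real:] ^ (M - j))"
    unfolding F_def by (rule degree_mult_le)
  also have "\<dots> \<le> M"
    using degree_power_le[of "[:1, -1::real:]" j] degree_power_le[of "[:1, 1::real:]" "M - j"] assms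
    by simp
  finally have "F = (\<Sum>k\<le>M. monom (coeff F k) k)" by (rule poly_as_sum_of_monoms'[symmetric])
  hence "poly F u = poly (\<Sum>k\<le>M. monom (coeff F k) k) u" by (rule arg_cong)
  also have "\<dots> = (\<Sum>k\<le>M. coeff F k * u ^ k)" by (simp add: poly_sum poly_monom)
  finally have "poly F u = (\<Sum>k\<le>M. coeff F k * u ^ k)" .
  thus ?thesis by (simp add: F_def kraw_gen_poly[OF assms] algebra_simps)
qed

lemma bivariate_coeff_eq:
  fixes a b :: "nat \<Rightarrow> nat \<Rightarrow> real"
  assumes "\<And>u v. (\<Sum>j\<le>n. \<Sum>k\<le>n. a j k * u ^ j * v ^ k) = (\<Sum>j\<le>n. \<Sum>k\<le>n. b j k * u ^ j * v ^ k)"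
    and "j \<le> n" "k \<le> n"
  shows "a j k = b j k"
proof -
  have "(\<Sum>k\<le>n. a j k * v ^ k) = (\<Sum>k\<le>n. b j k * v ^ k)" for v
  proof -
    have "\<forall>u. (\<Sum>j\<le>n. (\<Sum>k\<le>n. a j k * v ^ k) * u ^ j) = (\<Sum>j\<le>n. (\<Sum>k\<le>n. b j k * v ^ k) * u ^ j)"
    proof
      fix u
      have "(\<Sum>j\<le>n. (\<Sum>k\<le>n. c j k * v ^ k) * u ^ j) = (\<Sum>j\<le>n. \<Sum>k\<le>n. c j k * u ^ j * v ^ k)"
        for c :: "nat \<Rightarrow> nat \<Rightarrow> real"
        unfolding sum_distrib_right by (simp add: mult_ac)
      thus "(\<Sum>j\<le>n. (\<Sum>k\<le>n. a j k * v ^ k) * u ^ j) = (\<Sum>j\<le>n. (\<Sum>k\<le>n. b j k * v ^ k) * u ^ j)"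
        using assms(1) by presburger
    qed
    thus ?thesis using assms(2) unfolding polyfun_eq_coeffs by blast
  qed
  thus ?thesis using assms(3) polyfun_eq_coeffs[of "a j" n "b j"] by blast
qed

text \<open>
  Both sides are the coefficients of \<open>v ^ j * u ^ k\<close> in \<open>(1 + u + v - u * v) ^ M\<close>, which is symmetric
  in \<open>u\<close> and \<open>v\<close>.
\<close>
lemma kraw_self_dual:
  assumes "j \<le> M" "k \<le> M"
  shows "real (M choose j) * kraw_val M k j = real (M choose k) * kraw_val M j k"
proof (rule bivariate_coeff_eq[where a = "\<lambda>j k. real (M choose j) * kraw_val M k j"
      and b = "\<lambda>j k. real (M choose k) * kraw_val M j k", OF _ assms])
  have *: "(\<Sum>j\<le>M. \<Sum>k\<le>M. real (M choose j) * kraw_val M k j * v ^ j * u ^ k) = (1 + u + v - u * v) ^ M"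
    for u v :: real
  proof -
    have "(\<Sum>j\<le>M. \<Sum>k\<le>M. real (M choose j) * kraw_val M k j * v ^ j * u ^ k) =
        (\<Sum>j\<le>M. real (M choose j) * (v * (1 - u)) ^ j * (1 + u) ^ (M - j))"
    proof (rule sum.cong[OF refl])
      fix j assume "j \<in> {..M}"
      hence "(\<Sum>k\<le>M. real (M choose j) * kraw_val M k j * v ^ j * u ^ k) =
          real (M choose j) * v ^ j * ((1 - u) ^ j * (1 + u) ^ (M - j))"
        by (subst kraw_generating_function) (auto simp: sum_distrib_left mult_ac)
      thus "(\<Sum>k\<le>M. real (M choose j) * kraw_val M k j * v ^ j * u ^ k) =
          real (M choose j) * (v * (1 - u)) ^ j * (1 + u) ^ (M - j)"
        by (simp add: power_mult_distrib)
    qed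
    also have "\<dots> = (v * (1 - u) + (1 + u)) ^ M" by (rule binomial_ring[symmetric])
    finally show ?thesis by (simp add: algebra_simps)
  qed
  show "(\<Sum>j\<le>M. \<Sum>k\<le>M. real (M choose j) * kraw_val M k j * u ^ j * v ^ k) =
      (\<Sum>j\<le>M. \<Sum>k\<le>M. real (M choose k) * kraw_val M j k * u ^ j * v ^ k)" for u v
  proof -
    have "(\<Sum>j\<le>M. \<Sum>k\<le>M. real (M choose k) * kraw_val M j k * u ^ j * v ^ k) =
      (\<Sum>j\<le>M. \<Sum>k\<le>M. real (M choose j) * kraw_val M k j * v ^ j * u ^ k)"
      by (subst sum.swap) (simp add: mult_ac)
    thus ?thesis unfolding * by (simp add: algebra_simps)
  qed
qed

text \<open>
  By the binomial theorem the two-variable generating function of the left-hand side is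
  \<open>((1 - u) * (1 - v) + (1 + u) * (1 + v)) ^ M = 2 ^ M * (1 + u * v) ^ M\<close>.
\<close>
lemma kraw_orthogonal:
  assumes "k \<le> M" "l \<le> M"
  shows "(\<Sum>j\<le>M. real (M choose j) * (kraw_val M k j * kraw_val M l j)) =
    (if k = l then 2 ^ M * real (M choose k) else 0)"
proof (rule bivariate_coeff_eq[where a = "\<lambda>k l. \<Sum>j\<le>M. real (M choose j) * (kraw_val M k j * kraw_val M l j)"
      and b = "\<lambda>k l. if k = l then 2 ^ M * real (M choose k) else 0", OF _ assms])
  fix u v :: real
  have "(\<Sum>k\<le>M. \<Sum>l\<le>M. (\<Sum>j\<le>M. real (M choose j) * (kraw_val M k j * kraw_val M l j)) * u ^ k * v ^ l) =
      (\<Sum>j\<le>M. real (M choose j) * ((\<Sum>k\<le>M. kraw_val M k j * u ^ k) * (\<Sum>l\<le>M. kraw_val M l j * v ^ l)))"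
  proof -
    have "(\<Sum>k\<le>M. \<Sum>l\<le>M. (\<Sum>j\<le>M. real (M choose j) * (kraw_val M k j * kraw_val M l j)) * u ^ k * v ^ l) =
      (\<Sum>k\<le>M. \<Sum>j\<le>M. \<Sum>l\<le>M. real (M choose j) * (kraw_val M k j * u ^ k * (kraw_val M l j * v ^ l)))"
      unfolding sum_distrib_right
      by (rule sum.cong[OF refl], subst sum.swap) (simp add: mult_ac)
    also have "\<dots> = (\<Sum>j\<le>M. \<Sum>k\<le>M. \<Sum>l\<le>M. real (M choose j) * (kraw_val M k j * u ^ k * (kraw_val M l j * v ^ l)))"
      by (rule sum.swap)
    finally show ?thesis unfolding sum_product unfolding sum_distrib_left .
  qed
  also have "\<dots> = (\<Sum>j\<le>M. real (M choose j) * ((1 - u) * (1 - v)) ^ j * ((1 + u) * (1 + v)) ^ (M - j))"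
    by (intro sum.cong refl) (simp add: kraw_generating_function[symmetric] power_mult_distrib)
  also have "\<dots> = ((1 - u) * (1 - v) + (1 + u) * (1 + v)) ^ M"
    by (rule binomial_ring[symmetric])
  also have "\<dots> = 2 ^ M * (u * v + 1) ^ M"
    unfolding power_mult_distrib[symmetric] by (simp add: algebra_simps)
  also have "\<dots> = (\<Sum>k\<le>M. \<Sum>l\<le>M. (if k = l then 2 ^ M * real (M choose k) else 0) * u ^ k * v ^ l)"
  proof -
    have "2 ^ M * (u * v + 1) ^ M = (\<Sum>k\<le>M. 2 ^ M * real (M choose k) * u ^ k * v ^ k)"
      unfolding binomial_ring by (simp add: sum_distrib_left power_mult_distrib mult_ac)
    also have "\<dots> = (\<Sum>k\<le>M. \<Sum>l\<le>M. if k = l then 2 ^ M * real (M choose k) * u ^ k * v ^ l else 0)"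
      by (intro sum.cong refl) simp
    also have "\<dots> = (\<Sum>k\<le>M. \<Sum>l\<le>M. (if k = l then 2 ^ M * real (M choose k) else 0) * u ^ k * v ^ l)"
      by (intro sum.cong refl) simp
    finally show ?thesis .
  qed
  finally show "(\<Sum>k\<le>M. \<Sum>l\<le>M. (\<Sum>j\<le>M. real (M choose j) * (kraw_val M k j * kraw_val M l j)) * u ^ k * v ^ l) =
    (\<Sum>k\<le>M. \<Sum>l\<le>M. (if k = l then 2 ^ M * real (M choose k) else 0) * u ^ k * v ^ l)" .
qed

lemma sum_kr_space: "(\<Sum>z\<in>kr_space N. f z) = (\<Sum>j\<le>2 * N. f (int N - int j))"
proof (rule sum.reindex_bij_betw[symmetric])
  show "bij_betw (\<lambda>j. int N - int j) {..2 * N} (kr_space N)"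
    by (rule bij_betwI[of _ _ _ "\<lambda>z. nat (int N - z)"]) (auto simp: kr_space_def)
qed

lemma kr_weight_shift:
  assumes "j \<le> 2 * N"
  shows "kr_weight N (int N - int j) = real (2 * N choose j) / 2 ^ (2 * N)"
proof -
  have "nat (int N + (int N - int j)) = 2 * N - j" by auto
  thus ?thesis using assms by (simp add: kr_weight_def binomial_symmetric[of j "2 * N"])
qed

lemma kraw_expansion:
  assumes "\<And>i. i \<ge> m \<Longrightarrow> coeff q i = 0"
  shows "\<exists>b. q = (\<Sum>l<m. smult (b l) (kraw M l))"
  using assms
proof (induction m arbitrary: q)
  case 0
  thus ?case by (auto simp: poly_eq_iff)
next
  case (Suc m)
  define c where "c = coeff q m / coeff (kraw M m) m"
  have nz: "coeff (kraw M m) m \<noteq> 0" unfolding coeff_kraw_self by simp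
  have "\<exists>b. q - smult c (kraw M m) = (\<Sum>l<m. smult (b l) (kraw M l))"
  proof (rule Suc.IH)
    fix i assume "i \<ge> m"
    show "coeff (q - smult c (kraw M m)) i = 0"
    proof (cases "i = m")
      case True
      thus ?thesis using nz by (simp add: c_def)
    next
      case False
      thus ?thesis using \<open>i \<ge> m\<close> Suc.prems[of i] degree_kraw[of M m] by (simp add: coeff_eq_0)
    qed
  qed
  then obtain b where "q - smult c (kraw M m) = (\<Sum>l<m. smult (b l) (kraw M l))" by blast
  hence "q = (\<Sum>l<Suc m. smult ((b(m := c)) l) (kraw M l))" by (simp add: algebra_simps)
  thus ?case by blast
qed

lemma kr_poly_0_eq_kraw:
  assumes m: "m \<le> 2 * N"
  shows "kr_poly 0 N m = smult (fact m / 2 ^ m) (kraw (2 * N) m)"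
proof (rule monic_orth_poly_unique[OF _ _ _ is_monic_orth_poly_kr_poly])
  show "is_monic_orth_poly (kr_space N) (kr_weight_d 0 N) m (smult (fact m / 2 ^ m) (kraw (2 * N) m))"
    unfolding is_monic_orth_poly_def
  proof (intro conjI allI impI)
    show "degree (smult (fact m / 2 ^ m) (kraw (2 * N) m)) = m" using degree_kraw[of "2 * N" m] by simp
    show "lead_coeff (smult (fact m / 2 ^ m) (kraw (2 * N) m)) = 1"
      using degree_kraw[of "2 * N" m] coeff_kraw_self[of "2 * N" m] by simp
    fix q :: "real poly" assume q: "degree q < m"
    obtain b where b: "q = (\<Sum>l<m. smult (b l) (kraw (2 * N) l))"
      using kraw_expansion[of m q "2 * N"] q by (auto simp: coeff_eq_0)
    have "(\<Sum>z\<in>kr_space N. poly (kraw (2 * N) m) (of_int z) * poly q (of_int z) * kr_weight N z) =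
        (\<Sum>j\<le>2 * N. \<Sum>l<m. b l / 2 ^ (2 * N) *
            (real (2 * N choose j) * (kraw_val (2 * N) m j * kraw_val (2 * N) l j)))"
      unfolding sum_kr_space b
      by (intro sum.cong refl)
        (simp add: kr_weight_shift poly_sum sum_distrib_left sum_distrib_right sum_divide_distrib mult_ac)
    also have "\<dots> = (\<Sum>l<m. b l / 2 ^ (2 * N) *
            (\<Sum>j\<le>2 * N. real (2 * N choose j) * (kraw_val (2 * N) m j * kraw_val (2 * N) l j)))"
      unfolding sum_distrib_left by (rule sum.swap)
    also have "\<dots> = 0"
      using m by (intro sum.neutral ballI) (subst kraw_orthogonal, auto)
    finally show "(\<Sum>z\<in>kr_space N. poly (smult (fact m / 2 ^ m) (kraw (2 * N) m)) (of_int z) *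
        poly q (of_int z) * kr_weight_d 0 N z) = 0"
      by (simp add: kr_weight_d_def mult.assoc flip: sum_divide_distrib sum_distrib_left)
  qed
  show "m \<le> card {z \<in> kr_space N. kr_weight_d 0 N z \<noteq> 0}"
    using m unfolding card_kr_support by simp
qed (use m in \<open>auto simp: kr_weight_d_def kr_weight_def kr_space_def\<close>)

lemma kr_norm_0_eq:
  assumes m: "m \<le> 2 * N"
  shows "kr_norm 0 N m = fact m / 2 ^ m * sqrt (real (2 * N choose m))"
proof -
  have "(\<Sum>z\<in>kr_space N. (poly (kr_poly 0 N m) (of_int z))\<^sup>2 * kr_weight_d 0 N z) =
      (fact m / 2 ^ m)\<^sup>2 / 2 ^ (2 * N) *
      (\<Sum>j\<le>2 * N. real (2 * N choose j) * (kraw_val (2 * N) m j * kraw_val (2 * N) m j))"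
    unfolding sum_kr_space sum_distrib_left
    by (intro sum.cong refl)
      (simp add: kr_poly_0_eq_kraw[OF m] kr_weight_d_def kr_weight_shift power2_eq_square mult_ac)
  also have "\<dots> = (fact m / 2 ^ m)\<^sup>2 * real (2 * N choose m)"
    using m by (subst kraw_orthogonal) auto
  finally show ?thesis by (simp add: kr_norm_def real_sqrt_mult)
qed

text \<open>
  Self-duality exchanges degree and position: near the edge of the lattice the orthonormal functions
  become polynomials of fixed degrees \<open>x\<close> and \<open>y\<close> in the index \<open>m\<close>, weighted by the binomial distribution
  of \<open>m\<close>.
\<close>
lemma kr_fun_0_product:
  assumes m: "m \<le> 2 * N" and xy: "x \<le> 2 * N" "y \<le> 2 * N"
  shows "kr_fun 0 N m (int N - int x) * kr_fun 0 N m (int N - int y) =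
    real (2 * N choose m) / 2 ^ (2 * N) * (kraw_val (2 * N) x m * kraw_val (2 * N) y m) /
      sqrt (real (2 * N choose x) * real (2 * N choose y))"
proof -
  define C where "C j = real (2 * N choose j)" for j
  have C0: "C m > 0" "C x > 0" "C y > 0" using assms by (auto simp: C_def)
  have kf: "kr_fun 0 N m (int N - int z) = sqrt (C m / 2 ^ (2 * N)) * kraw_val (2 * N) z m / sqrt (C z)"
    if z: "z \<le> 2 * N" "C z > 0" for z
  proof -
    have dual: "kraw_val (2 * N) m z = C m * kraw_val (2 * N) z m / C z"
      using kraw_self_dual[OF z(1) m] z(2) by (simp add: C_def field_simps)
    have "kr_fun 0 N m (int N - int z) = kraw_val (2 * N) m z * sqrt (C z / 2 ^ (2 * N)) / sqrt (C m)"
      by (simp add: kr_fun_def kr_poly_0_eq_kraw[OF m] kr_norm_0_eq[OF m] kr_weight_shift[OF z(1)] C_def)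
    also have "\<dots> = sqrt (C m / 2 ^ (2 * N)) * kraw_val (2 * N) z m / sqrt (C z)"
      unfolding dual real_sqrt_divide using z(2) C0
      by (simp add: field_simps)
    finally show ?thesis .
  qed
  show ?thesis
    unfolding kf[OF xy(1) C0(2)] kf[OF xy(2) C0(3)] C_def[symmetric] real_sqrt_mult
  proof -
    have "sqrt (C m / 2 ^ (2 * N)) * sqrt (C m / 2 ^ (2 * N)) = C m / 2 ^ (2 * N)"
      using C0(1) by simp
    moreover have "s * a / p * (s * b / q) = (s * s) * (a * b) / (p * q)" for s a b p q :: real
      by simp
    ultimately show "sqrt (C m / 2 ^ (2 * N)) * kraw_val (2 * N) x m / sqrt (C x) *
        (sqrt (C m / 2 ^ (2 * N)) * kraw_val (2 * N) y m / sqrt (C y)) =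
        C m / 2 ^ (2 * N) * (kraw_val (2 * N) x m * kraw_val (2 * N) y m) / (sqrt (C x) * sqrt (C y))"
      by presburger
  qed
qed

section \<open>The limit from Krawtchouk to Hermite polynomials\<close>
lemma hermite_three_term:
  "hermite (Suc (Suc k)) = [:0, 2:] * hermite (Suc k) - smult (2 * (real k + 1)) (hermite k)"
proof -
  have d: "pderiv (hermite_rec (Suc k)) = smult (2 * (real k + 1)) (hermite_rec k)" for k
  proof (induction k)
    case (Suc k)
    have "pderiv (hermite_rec (Suc (Suc k))) =
        smult 2 (hermite_rec (Suc k)) + ([:0, 2:] * pderiv (hermite_rec (Suc k))
          - pderiv (pderiv (hermite_rec (Suc k))))"
      by (subst hermite_rec.simps(2), simp only: pderiv_diff pderiv_mult)
        (simp add: pderiv_pCons)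
    also have "\<dots> = smult 2 (hermite_rec (Suc k)) + smult (2 * (real k + 1)) (hermite_rec (Suc k))"
      unfolding Suc pderiv_smult by (simp add: algebra_simps smult_diff_right)
    finally show ?case by (simp add: algebra_simps flip: smult_add_left)
  qed (simp add: pderiv_pCons)
  show ?thesis
    unfolding hermite_eq_hermite_rec using d[of k] by (subst hermite_rec.simps(2)) simp
qed

text \<open>
  The Krawtchouk polynomial on \<open>2 * N + 1\<close> points in the variable \<open>t = a + z / sqrt N\<close>, divided by
  \<open>sqrt N ^ k\<close>. The shift \<open>a\<close> will be chosen so that the cut-off in the sum over the degrees falls exactly
  at a point independent of \<open>N\<close>.
\<close>
fun scaled_kraw :: "nat \<Rightarrow> real \<Rightarrow> nat \<Rightarrow> real poly" where
  "scaled_kraw N a 0 = 1"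
| "scaled_kraw N a (Suc 0) = [:- 2 * a, 2:]"
| "scaled_kraw N a (Suc (Suc k)) = smult (1 / real (k + 2))
     ([:- 2 * a, 2:] * scaled_kraw N a (Suc k) - smult (2 - real k / real N) (scaled_kraw N a k))"

lemma tendsto_coeff_linear_mult:
  assumes "a \<longlonglongrightarrow> (b :: real)" "\<And>i. (\<lambda>N. coeff (p N) i) \<longlonglongrightarrow> coeff q i"
  shows "(\<lambda>N. coeff ([:a N, 2:] * p N) i) \<longlonglongrightarrow> coeff ([:b, 2:] * q) i"
  by (cases i) (auto simp: coeff_pCons intro!: tendsto_intros assms)

text \<open>
  As \<open>N\<close> grows, the recurrence of the rescaled polynomials turns into that of the Hermite polynomials
  divided by factorials. Convergence of coefficients suffices because the degree is fixed.
\<close>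
lemma scaled_kraw_tendsto_hermite:
  assumes a: "a \<longlonglongrightarrow> 0"
  shows "(\<lambda>N. coeff (scaled_kraw N (a N) x) i) \<longlonglongrightarrow> coeff (smult (1 / fact x) (hermite x)) i"
proof (induction x arbitrary: i rule: induct_nat_012)
  case 0
  show ?case by (cases i) (simp_all add: hermite_eq_hermite_rec one_pCons)
next
  case 1
  have "(\<lambda>N. coeff ([:- 2 * a N, 2:] * 1) i) \<longlonglongrightarrow> coeff ([:- 2 * 0, 2:] * 1) i"
    by (intro tendsto_coeff_linear_mult tendsto_mult tendsto_const a)
  thus ?case by (simp add: hermite_eq_hermite_rec)
next
  case (ge2 k)
  define h where "h k = smult (1 / fact k) (hermite k)" for k
  have rec: "h (Suc (Suc k)) = smult (1 / real (k + 2)) ([:- 2 * 0, 2:] * h (Suc k) - smult (2 - 0) (h k))"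
  proof -
    obtain P Q where PQ: "P = real k + 1" "Q = real (k + 2)" by blast
    have nz: "P \<noteq> 0" "Q \<noteq> 0" using PQ by auto
    have "(fact (Suc k) :: real) = P * fact k" "(fact (Suc (Suc k)) :: real) = Q * (P * fact k)"
      using PQ by (simp_all add: algebra_simps)
    thus ?thesis unfolding h_def hermite_three_term PQ[symmetric]
      using nz by (simp add: smult_diff_right field_simps)
  qed
  have "(\<lambda>N. real k / real N) \<longlonglongrightarrow> 0"
    by (rule lim_const_over_n)
  hence "(\<lambda>N. coeff (scaled_kraw N (a N) (Suc (Suc k))) i) \<longlonglongrightarrow>
      coeff (smult (1 / real (k + 2)) ([:- 2 * 0, 2:] * h (Suc k) - smult (2 - 0) (h k))) i"
    unfolding scaled_kraw.simps coeff_smult coeff_diff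
    by (intro tendsto_intros tendsto_coeff_linear_mult)
       (use ge2 a in \<open>auto simp: h_def intro!: tendsto_eq_intros\<close>)
  thus ?case unfolding rec[symmetric] by (simp only: h_def)
qed

lemma degree_scaled_kraw: "degree (scaled_kraw N a x) \<le> x"
proof (induction x rule: induct_nat_012)
  case (ge2 k)
  have "degree ([:- 2 * a, 2:] * scaled_kraw N a (Suc k)) \<le> 1 + Suc k"
    using ge2 by (intro order_trans[OF degree_mult_le] add_mono) auto
  moreover have "degree (smult (2 - real k / real N) (scaled_kraw N a k)) \<le> 1 + Suc k"
    using ge2 by (intro order_trans[OF degree_smult_le]) auto
  ultimately have "degree ([:- 2 * a, 2:] * scaled_kraw N a (Suc k)
      - smult (2 - real k / real N) (scaled_kraw N a k)) \<le> Suc (Suc k)"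
    by (intro degree_diff_le) (simp_all del: mult_pCons_left)
  thus ?case unfolding scaled_kraw.simps by (rule order_trans[OF degree_smult_le])
qed auto

lemma binomial_scaling_limit:
  "(\<lambda>N. real (2 * N choose x) / real N ^ x) \<longlonglongrightarrow> 2 ^ x / fact x"
proof (induction x)
  case (Suc x)
  have eq: "real (2 * N choose Suc x) / real N ^ Suc x =
      real (2 * N choose x) / real N ^ x * ((2 - real x / real N) / real (Suc x))"
    if "N > x" for N
  proof -
    have "Suc x * (2 * N choose Suc x) = (2 * N - x) * (2 * N choose x)"
      by (metis binomial_absorb_comp binomial_absorption mult.commute)
    hence "real (Suc x) * real (2 * N choose Suc x) = (2 * real N - real x) * real (2 * N choose x)"
      using that by (metis (mono_tags, lifting) less_imp_le_nat mult_2 of_nat_add of_nat_diff of_nat_mult trans_le_add1)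
    hence "real (2 * N choose Suc x) = (2 * real N - real x) * real (2 * N choose x) / real (Suc x)"
      by (simp add: field_simps del: of_nat_Suc)
    thus ?thesis using that by (simp add: field_simps del: of_nat_Suc)
  qed
  have "(\<lambda>N. real (2 * N choose x) / real N ^ x * ((2 - real x / real N) / real (Suc x)))
      \<longlonglongrightarrow> 2 ^ x / fact x * ((2 - 0) / real (Suc x))"
    by (intro tendsto_intros Suc lim_const_over_n) auto
  moreover have "\<forall>\<^sub>F N in sequentially. real (2 * N choose x) / real N ^ x * ((2 - real x / real N) / real (Suc x))
      = real (2 * N choose Suc x) / real N ^ Suc x"
    using eventually_gt_at_top[of x] by eventually_elim (rule eq[symmetric])
  ultimately have "(\<lambda>N. real (2 * N choose Suc x) / real N ^ Suc x) \<longlonglongrightarrow> 2 ^ x / fact x * ((2 - 0) / real (Suc x))"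
    by (rule Lim_transform_eventually)
  thus ?case by (simp add: field_simps)
qed simp

section \<open>Convergence of truncated moments\<close>

lemma (in real_distribution) truncation_error:
  assumes int: "integrable M (\<lambda>t. \<bar>t\<bar> ^ Suc p)"
    and [measurable]: "f \<in> borel_measurable borel"
    and f: "\<And>t. \<bar>f t\<bar> \<le> \<bar>t\<bar> ^ p" and A: "A > 0"
  shows "\<bar>(LINT t|M. indicator {-A..A} t * f t) - (LINT t|M. f t)\<bar> \<le> (LINT t|M. \<bar>t\<bar> ^ Suc p) / A"
proof -
  have le: "\<bar>t\<bar> ^ p \<le> 1 + \<bar>t\<bar> ^ Suc p" for t :: real
  proof (cases "\<bar>t\<bar> \<le> 1")
    case True
    hence "\<bar>t\<bar> ^ p \<le> 1" by (intro power_le_one) auto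
    thus ?thesis by (rule add_increasing2[rotated]) simp
  next
    case False
    hence "\<bar>t\<bar> ^ p \<le> \<bar>t\<bar> ^ Suc p" by (intro power_increasing) auto
    thus ?thesis by simp
  qed
  have int1: "integrable M (\<lambda>t. 1 + \<bar>t\<bar> ^ Suc p)" using int by simp
  have intf: "integrable M f"
    by (rule Bochner_Integration.integrable_bound[OF int1]) (auto intro!: AE_I2 order_trans[OF f] order_trans[OF le])
  have intf': "integrable M (\<lambda>t. indicator {-A..A} t * f t)"
    by (rule Bochner_Integration.integrable_bound[OF intf]) (auto intro!: AE_I2 simp: indicator_def)
  have "\<bar>(LINT t|M. indicator {-A..A} t * f t) - (LINT t|M. f t)\<bar> =
      norm (LINT t|M. indicator {-A..A} t * f t - f t)"
    using intf intf' by simp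
  also have "\<dots> \<le> (LINT t|M. norm (indicator {-A..A} t * f t - f t))"
    by (rule integral_norm_bound)
  also have "\<dots> \<le> (LINT t|M. \<bar>t\<bar> ^ Suc p / A)"
  proof (rule integral_mono)
    fix t :: real
    show "norm (indicator {-A..A} t * f t - f t) \<le> \<bar>t\<bar> ^ Suc p / A"
    proof (cases "t \<in> {-A..A}")
      case False
      hence "A \<le> \<bar>t\<bar>" by auto
      have "\<bar>f t\<bar> * A \<le> \<bar>t\<bar> ^ p * \<bar>t\<bar>"
        using f[of t] \<open>A \<le> \<bar>t\<bar>\<close> A by (intro mult_mono) auto
      thus ?thesis using False A by (simp add: field_simps)
    qed (use A in auto)
  qed (use intf intf' int in auto)
  finally show ?thesis by simp
qed

text \<open>
  Weak convergence controls only bounded functions. A function of polynomial growth is cut off to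
  \<open>[-A, A]\<close>; bounded moments of the next order make the error \<open>O(1 / A)\<close> uniformly in \<open>n\<close>, so that the
  limits in \<open>n\<close> and \<open>A\<close> may be exchanged.
\<close>
lemma weak_conv_moment_convergence:
  assumes \<mu>: "\<And>n. real_distribution (\<mu> n)" and \<nu>: "real_distribution \<nu>" and conv: "weak_conv_m \<mu> \<nu>"
    and int\<mu>: "\<And>n. integrable (\<mu> n) (\<lambda>t. \<bar>t\<bar> ^ Suc p)" and int\<nu>: "integrable \<nu> (\<lambda>t. \<bar>t\<bar> ^ Suc p)"
    and bound: "\<And>n. (LINT t|\<mu> n. \<bar>t\<bar> ^ Suc p) \<le> C"
    and no_atom: "\<And>c. emeasure \<nu> {c} = 0"
    and f [measurable]: "f \<in> borel_measurable borel" and f_le: "\<And>t. \<bar>f t\<bar> \<le> \<bar>t\<bar> ^ p"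
    and cont: "\<And>t. t \<noteq> r \<Longrightarrow> isCont f t"
  shows "(\<lambda>n. LINT t|\<mu> n. f t) \<longlonglongrightarrow> (LINT t|\<nu>. f t)"
proof -
  interpret \<mu>: real_distribution "\<mu> n" for n by (rule \<mu>)
  interpret \<nu>: real_distribution \<nu> by (rule \<nu>)
  define F where "F m t = indicator {- real (Suc m)..real (Suc m)} t * f t" for m and t :: real
  have F_meas [measurable]: "F m \<in> borel_measurable borel" for m unfolding F_def by measurable
  have over_Suc: "(\<lambda>m. c / real (Suc m)) \<longlonglongrightarrow> 0" for c
    by (rule LIMSEQ_Suc[OF lim_const_over_n])
  show ?thesis
  proof (rule swap_uniform_limit')
    show "\<forall>\<^sub>F m in sequentially. (\<lambda>n. LINT t|\<mu> n. F m t) \<longlonglongrightarrow> (LINT t|\<nu>. F m t)"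
    proof (intro always_eventually allI)
      fix m
      show "(\<lambda>n. LINT t|\<mu> n. F m t) \<longlonglongrightarrow> (LINT t|\<nu>. F m t)"
      proof (rule weak_conv_imp_bdd_ae_continuous_conv[OF \<mu> \<nu> conv])
        let ?D = "{r, - real (Suc m), real (Suc m)}"
        have "isCont (F m) t" if "t \<notin> ?D" for t
        proof -
          have "isCont (indicator {- real (Suc m)..real (Suc m)} :: real \<Rightarrow> real) t"
            using that by (simp add: isCont_indicator frontier_cbox[where 'a = real, simplified] del: of_nat_Suc)
          thus ?thesis unfolding F_def using that cont by (intro continuous_intros) auto
        qed
        hence sub: "{t. \<not> isCont (F m) t} \<subseteq> ?D" by blast
        have "?D \<in> null_sets \<nu>"
        proof -
          have "{c} \<in> null_sets \<nu>" for c using no_atom[of c] by (simp add: null_sets_def)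
          hence "{r} \<union> {- real (Suc m)} \<union> {real (Suc m)} \<in> null_sets \<nu>" by blast
          thus ?thesis by (simp add: insert_commute)
        qed
        moreover have "{t. \<not> isCont (F m) t} \<in> sets \<nu>"
          using finite_subset[OF sub] by (simp add: finite_imp_closed borel_closed)
        ultimately have "{t. \<not> isCont (F m) t} \<in> null_sets \<nu>" using sub by (rule null_sets_subset)
        thus "emeasure \<nu> {t. \<not> isCont (F m) t} = 0" by auto
        show "norm (F m t) \<le> real (Suc m) ^ p" for t
        proof (cases "t \<in> {- real (Suc m)..real (Suc m)}")
          case True
          hence "\<bar>t\<bar> ^ p \<le> real (Suc m) ^ p" by (intro power_mono) auto
          thus ?thesis using f_le[of t] True by (simp add: F_def)
        qed (simp add: F_def)
      qed measurable
    qed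
    show "(\<lambda>m. LINT t|\<nu>. F m t) \<longlonglongrightarrow> (LINT t|\<nu>. f t)"
    proof (rule LIM_zero_cancel, rule Lim_null_comparison[OF _ over_Suc])
      show "\<forall>\<^sub>F m in sequentially. norm ((LINT t|\<nu>. F m t) - (LINT t|\<nu>. f t))
          \<le> (LINT t|\<nu>. \<bar>t\<bar> ^ Suc p) / real (Suc m)"
        unfolding F_def real_norm_def
        by (intro always_eventually allI \<nu>.truncation_error int\<nu> f f_le) auto
    qed
    show "uniform_limit UNIV (\<lambda>m n. LINT t|\<mu> n. F m t) (\<lambda>n. LINT t|\<mu> n. f t) sequentially"
    proof (rule uniform_limitI)
      fix e :: real assume "e > 0"
      have "\<forall>\<^sub>F m in sequentially. C / real (Suc m) < e"
        by (rule order_tendstoD(2)[OF over_Suc \<open>e > 0\<close>])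
      thus "\<forall>\<^sub>F m in sequentially. \<forall>n\<in>UNIV. dist (LINT t|\<mu> n. F m t) (LINT t|\<mu> n. f t) < e"
      proof eventually_elim
        case (elim m)
        show ?case
        proof
          fix n
          have "dist (LINT t|\<mu> n. F m t) (LINT t|\<mu> n. f t) \<le> (LINT t|\<mu> n. \<bar>t\<bar> ^ Suc p) / real (Suc m)"
            unfolding F_def dist_real_def
            by (intro \<mu>.truncation_error int\<mu> f f_le) auto
          also have "\<dots> \<le> C / real (Suc m)" using bound by (intro divide_right_mono) auto
          finally show "dist (LINT t|\<mu> n. F m t) (LINT t|\<mu> n. f t) < e" using elim by simp
        qed
      qed
    qed
  qed auto
qed

section \<open>The even half of the symmetric binomial distribution\<close>

text \<open>
  The symmetric binomial distribution with \<open>2 * N\<close> trials, conditioned to be even, is rescaled by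
  \<open>sqrt N\<close>, reflected and shifted by \<open>a\<close>. The index \<open>l\<close> stands for the even outcome \<open>2 * l\<close>, which is
  the degree in the sum that defines the kernel.
\<close>
definition even_mass :: "nat \<Rightarrow> nat \<Rightarrow> real" where
  "even_mass N l = 2 * real (2 * N choose (2 * l)) / 2 ^ (2 * N)"

definition even_point :: "nat \<Rightarrow> real \<Rightarrow> nat \<Rightarrow> real" where
  "even_point N a l = a + (real N - 2 * real l) / sqrt (real N)"

definition even_binomial :: "nat \<Rightarrow> real \<Rightarrow> real measure" where
  "even_binomial N a = distr (point_measure {..N} (even_mass N)) borel (even_point N a)"

lemma even_mass_nonneg: "even_mass N l \<ge> 0"
  by (simp add: even_mass_def)

lemma integrable_even_binomial:
  fixes g :: "real \<Rightarrow> 'a::{banach, second_countable_topology}"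
  assumes "g \<in> borel_measurable borel"
  shows "integrable (even_binomial N a) g"
  unfolding even_binomial_def using assms
  by (subst integrable_distr_eq) (auto simp: integrable_point_measure_finite)

lemma integral_even_binomial:
  fixes g :: "real \<Rightarrow> 'a::{banach, second_countable_topology}"
  assumes "g \<in> borel_measurable borel"
  shows "integral\<^sup>L (even_binomial N a) g = (\<Sum>l\<le>N. even_mass N l *\<^sub>R g (even_point N a l))"
  unfolding even_binomial_def using assms
  by (subst integral_distr) (auto simp: lebesgue_integral_point_measure_finite even_mass_nonneg)

lemma sum_even_indices:
  fixes F :: "nat \<Rightarrow> 'a::comm_ring_1"
  shows "(\<Sum>l\<le>N. 2 * F (2 * l)) = (\<Sum>k\<le>2 * N. F k) + (\<Sum>k\<le>2 * N. (-1) ^ k * F k)"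
  by (induction N) (simp_all add: algebra_simps)

text \<open>
  Restricting a sum to even \<open>k\<close> means averaging it with its alternating version; the full binomial sum
  produces the hyperbolic cosine and the alternating one the hyperbolic sine.
\<close>
lemma even_mass_exponential_sum:
  fixes z :: "'a::{real_normed_field, banach}"
  shows "(\<Sum>l\<le>N. even_mass N l *\<^sub>R exp (z * of_real (real N - 2 * real l))) =
    cosh (z / 2) ^ (2 * N) + sinh (z / 2) ^ (2 * N)"
proof -
  define w where "w = exp (z / 2)"
  define w' where "w' = exp (- (z / 2))"
  define F :: "nat \<Rightarrow> 'a" where "F k = of_nat (2 * N choose k) * w' ^ k * w ^ (2 * N - k) / 2 ^ (2 * N)" for k
  have "even_mass N l *\<^sub>R exp (z * of_real (real N - 2 * real l)) = 2 * F (2 * l)" if "l \<le> N" for l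
  proof -
    have "w' ^ (2 * l) * w ^ (2 * N - 2 * l) = exp (of_nat (2 * l) * (- (z / 2)) + of_nat (2 * N - 2 * l) * (z / 2))"
      unfolding w_def w'_def exp_add exp_of_nat_mult ..
    also have "of_nat (2 * l) * (- (z / 2)) + of_nat (2 * N - 2 * l) * (z / 2) = z * of_real (real N - 2 * real l)"
      using that by (simp add: of_nat_diff algebra_simps add_divide_distrib diff_divide_distrib)
    finally show ?thesis
      by (simp add: F_def even_mass_def scaleR_conv_of_real mult.assoc)
  qed
  hence "(\<Sum>l\<le>N. even_mass N l *\<^sub>R exp (z * of_real (real N - 2 * real l))) = (\<Sum>l\<le>N. 2 * F (2 * l))"
    by simp
  also have "\<dots> = (\<Sum>k\<le>2 * N. F k) + (\<Sum>k\<le>2 * N. (-1) ^ k * F k)" by (rule sum_even_indices)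
  also have "(\<Sum>k\<le>2 * N. F k) = (w' + w) ^ (2 * N) / 2 ^ (2 * N)"
    unfolding binomial_ring F_def sum_divide_distrib ..
  also have "(\<Sum>k\<le>2 * N. (-1) ^ k * F k) = (- w' + w) ^ (2 * N) / 2 ^ (2 * N)"
    unfolding binomial_ring F_def sum_divide_distrib
    by (intro sum.cong refl) (simp add: power_minus[of w'] mult_ac)
  also have "(w' + w) ^ (2 * N) / 2 ^ (2 * N) = cosh (z / 2) ^ (2 * N)"
    by (simp add: cosh_def w_def w'_def scaleR_conv_of_real add.commute flip: power_divide)
  also have "(- w' + w) ^ (2 * N) / 2 ^ (2 * N) = sinh (z / 2) ^ (2 * N)"
    by (simp add: sinh_def w_def w'_def scaleR_conv_of_real flip: power_divide)
  finally show ?thesis .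
qed

lemma exponential_moment_even_binomial:
  fixes z :: "'a::{real_normed_field, banach, second_countable_topology}"
  shows "(LINT t|even_binomial N a. exp (z * of_real t)) = exp (z * of_real a) *
    (cosh (z / of_real (2 * sqrt (real N))) ^ (2 * N) + sinh (z / of_real (2 * sqrt (real N))) ^ (2 * N))"
proof -
  define y where "y = z / of_real (sqrt (real N))"
  have "exp (z * of_real (even_point N a l)) = exp (z * of_real a) * exp (y * of_real (real N - 2 * real l))" for l
    by (simp add: even_point_def y_def field_simps flip: exp_add)
  hence "(LINT t|even_binomial N a. exp (z * of_real t)) =
      exp (z * of_real a) * (\<Sum>l\<le>N. even_mass N l *\<^sub>R exp (y * of_real (real N - 2 * real l)))"
    by (subst integral_even_binomial) (simp_all add: sum_distrib_left)
  thus ?thesis unfolding even_mass_exponential_sum by (simp add: y_def mult.commute)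
qed

lemma real_distribution_even_binomial:
  assumes "N > 0" shows "real_distribution (even_binomial N a)"
proof -
  have "(\<Sum>l\<le>N. even_mass N l) = 1"
    using even_mass_exponential_sum[of N "0::real"] assms by simp
  hence "prob_space (point_measure {..N} (even_mass N))"
    by (intro prob_spaceI)
      (simp add: emeasure_point_measure_finite space_point_measure sum_ennreal even_mass_nonneg)
  thus ?thesis unfolding even_binomial_def
    by (rule prob_space.real_distribution_distr) simp
qed

lemma cos_power_limit: "(\<lambda>N. cos (s / (2 * sqrt (real N))) ^ (2 * N)) \<longlonglongrightarrow> exp (- s\<^sup>2 / 4)"
proof (cases "s = 0")
  case False
  have "(\<lambda>N. cos (s / (2 * sqrt (real N))) ^ (2 * N)) \<longlonglongrightarrow> exp (- (s * s / 4))"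
    using False by real_asymp
  thus ?thesis by (simp add: power2_eq_square)
qed simp

text \<open>
  This is the contribution of the alternating sum: the restriction to even outcomes is invisible in the
  limit.
\<close>
lemma sin_power_limit: "(\<lambda>N. sin (s / (2 * sqrt (real N))) ^ (2 * N)) \<longlonglongrightarrow> 0"
proof (rule Lim_null_comparison)
  have "(\<lambda>N. s / (2 * sqrt (real N))) \<longlonglongrightarrow> 0"
    by (cases "s = 0") (simp, real_asymp)
  hence "(\<lambda>N. sin (s / (2 * sqrt (real N)))) \<longlonglongrightarrow> sin 0" by (rule tendsto_sin)
  thus "(\<lambda>N. \<bar>sin (s / (2 * sqrt (real N)))\<bar>) \<longlonglongrightarrow> 0"
    by (intro tendsto_rabs_zero) simp
  show "\<forall>\<^sub>F N in sequentially. norm (sin (s / (2 * sqrt (real N))) ^ (2 * N)) \<le> \<bar>sin (s / (2 * sqrt (real N)))\<bar>"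
    using eventually_gt_at_top[of 0]
  proof eventually_elim
    case (elim N)
    have "\<bar>sin (s / (2 * sqrt (real N)))\<bar> ^ (2 * N) \<le> \<bar>sin (s / (2 * sqrt (real N)))\<bar> ^ 1"
      using elim by (intro power_decreasing) auto
    thus ?case by (simp only: power_one_right real_norm_def power_abs)
  qed
qed

text \<open>
  The normal distribution of variance \<open>1 / 2\<close>, whose density is \<open>exp (- t\<^sup>2) / sqrt pi\<close>; as an image of the
  standard one it inherits its characteristic function.
\<close>
definition normal_half_variance :: "real measure" where
  "normal_half_variance = distr std_normal_distribution borel (\<lambda>t. t / sqrt 2)"

lemma real_distribution_normal_half_variance: "real_distribution normal_half_variance"
proof -
  interpret real_distribution std_normal_distribution by (rule real_dist_normal_dist)
  show ?thesis unfolding normal_half_variance_def by (rule real_distribution_distr) simp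
qed

text \<open>
  The sequences start at \<open>Suc N\<close> because for \<open>N = 0\<close> the even masses add up to two.
\<close>
lemma even_binomial_weak_conv:
  assumes a: "a \<longlonglongrightarrow> 0"
  shows "weak_conv_m (\<lambda>N. even_binomial (Suc N) (a (Suc N))) normal_half_variance"
proof (rule levy_continuity)
  fix s :: real
  have char_eq: "char (even_binomial N (a N)) s = exp (\<i> * (s * a N)) *
      (of_real (cos (s / (2 * sqrt (real N))) ^ (2 * N)) + (-1) ^ N * of_real (sin (s / (2 * sqrt (real N))) ^ (2 * N)))"
    for N
  proof -
    define \<theta> where "\<theta> = s / (2 * sqrt (real N))"
    have "char (even_binomial N (a N)) s = (LINT t|even_binomial N (a N). exp ((\<i> * of_real s) * of_real t))"
      by (simp add: char_def mult.assoc)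
    also have "\<dots> = exp (\<i> * of_real s * of_real (a N)) *
        (cosh (\<i> * of_real \<theta>) ^ (2 * N) + sinh (\<i> * of_real \<theta>) ^ (2 * N))"
      unfolding exponential_moment_even_binomial by (simp add: \<theta>_def)
    also have "cosh (\<i> * of_real \<theta>) = of_real (cos \<theta>)"
      by (simp add: cos_of_real flip: cos_conv_cosh)
    also have "sinh (\<i> * of_real \<theta>) = \<i> * of_real (sin \<theta>)"
      using sin_conv_sinh[of "of_real \<theta>"] by (simp add: sin_of_real)
    finally show ?thesis
      by (simp add: \<theta>_def mult.assoc power_mult_distrib power_mult power_minus[of "_\<^sup>2"])
  qed
  have "(\<lambda>N. (-1) ^ N * complex_of_real (sin (s / (2 * sqrt (real N))) ^ (2 * N))) \<longlonglongrightarrow> 0"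
  proof (rule tendsto_norm_zero_cancel)
    show "(\<lambda>N. norm ((-1) ^ N * complex_of_real (sin (s / (2 * sqrt (real N))) ^ (2 * N)))) \<longlonglongrightarrow> 0"
      using tendsto_rabs_zero[OF sin_power_limit[of s]]
      by (simp add: norm_mult norm_power power_abs)
  qed
  hence "(\<lambda>N. char (even_binomial N (a N)) s) \<longlonglongrightarrow> exp (\<i> * complex_of_real (s * 0)) * (of_real (exp (- s\<^sup>2 / 4)) + 0)"
    unfolding char_eq by (intro tendsto_intros a cos_power_limit)
  moreover have "char normal_half_variance s = of_real (exp (- s\<^sup>2 / 4))"
  proof -
    have "char normal_half_variance s = char std_normal_distribution (s / sqrt 2)"
      unfolding normal_half_variance_def char_def by (subst integral_distr) simp_all
    thus ?thesis by (simp add: char_std_normal_distribution power_divide)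
  qed
  ultimately have "(\<lambda>N. char (even_binomial N (a N)) s) \<longlonglongrightarrow> char normal_half_variance s"
    by simp
  thus "(\<lambda>N. char (even_binomial (Suc N) (a (Suc N))) s) \<longlonglongrightarrow> char normal_half_variance s"
    by (rule LIMSEQ_Suc)
qed (auto intro: real_distribution_even_binomial real_distribution_normal_half_variance)

lemma power_le_exp_abs:
  assumes "q > 0" shows "\<bar>t :: real\<bar> ^ q \<le> real q ^ q * (exp t + exp (- t))"
proof -
  have "(\<bar>t\<bar> / real q) ^ q \<le> (1 + \<bar>t\<bar> / real q) ^ q" by (intro power_mono) auto
  also have "\<dots> \<le> exp \<bar>t\<bar>" using assms by (intro exp_ge_one_plus_x_over_n_power_n) auto
  also have "\<dots> \<le> exp t + exp (- t)" by (auto simp: abs_if)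
  finally show ?thesis using assms by (simp add: power_divide field_simps)
qed

text \<open>
  A power of \<open>t\<close> is dominated by \<open>exp t + exp (- t)\<close>, whose integral is explicit and convergent.
\<close>
lemma even_binomial_moments_bounded:
  assumes a: "a \<longlonglongrightarrow> 0" and q: "q > 0"
  shows "\<exists>C. \<forall>N. (LINT t|even_binomial N (a N). \<bar>t\<bar> ^ q) \<le> C"
proof -
  define E where "E N = cosh (1 / (2 * sqrt (real N))) ^ (2 * N) + sinh (1 / (2 * sqrt (real N))) ^ (2 * N)" for N
  define B where "B N = exp (a N) * E N + exp (- a N) * E N" for N
  have "(\<lambda>N. cosh (1 / (2 * sqrt (real N))) ^ (2 * N)) \<longlonglongrightarrow> exp (1 / 4)"
    unfolding cosh_field_def by real_asymp
  moreover have "(\<lambda>N. sinh (1 / (2 * sqrt (real N))) ^ (2 * N)) \<longlonglongrightarrow> 0"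
    unfolding sinh_field_def by real_asymp
  ultimately have "E \<longlonglongrightarrow> exp (1 / 4) + 0" unfolding E_def by (rule tendsto_add)
  hence "B \<longlonglongrightarrow> exp 0 * (exp (1 / 4) + 0) + exp (- 0) * (exp (1 / 4) + 0)"
    unfolding B_def by (intro tendsto_intros a)
  hence "Bseq B" by (rule convergent_imp_Bseq[OF convergentI])
  then obtain K where K: "\<And>N. norm (B N) \<le> K" by (meson BseqE)
  have "(LINT t|even_binomial N (a N). \<bar>t\<bar> ^ q) \<le> real q ^ q * K" for N
  proof -
    have "(LINT t|even_binomial N (a N). \<bar>t\<bar> ^ q) \<le>
        (LINT t|even_binomial N (a N). real q ^ q * (exp (1 * of_real t) + exp (- 1 * of_real t)))"
      using power_le_exp_abs[OF q] by (intro integral_mono integrable_even_binomial) auto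
    also have "\<dots> = real q ^ q * ((LINT t|even_binomial N (a N). exp (1 * of_real t)) +
        (LINT t|even_binomial N (a N). exp (- 1 * of_real t)))"
      by (subst integral_mult_right_zero, subst Bochner_Integration.integral_add) (auto intro: integrable_even_binomial)
    also have "\<dots> = real q ^ q * B N"
      unfolding exponential_moment_even_binomial by (simp add: B_def E_def)
    also have "\<dots> \<le> real q ^ q * K" using K[of N] by (intro mult_left_mono) auto
    finally show ?thesis .
  qed
  thus ?thesis by blast
qed

lemma integral_normal_half_variance:
  assumes [measurable]: "g \<in> borel_measurable borel"
  shows "(LINT t|normal_half_variance. g t) = (LINT t|lborel. g t * exp (- t\<^sup>2)) / sqrt pi"
proof -
  have "(LINT t|normal_half_variance. g t) = (LINT t|std_normal_distribution. g (t / sqrt 2))"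
    unfolding normal_half_variance_def by (subst integral_distr) simp_all
  also have "\<dots> = (LINT t|lborel. std_normal_density t * g (t / sqrt 2))"
    by (subst integral_density) simp_all
  also have "\<dots> = sqrt 2 * (LINT t|lborel. std_normal_density (sqrt 2 * t) * g t)"
    by (subst lborel_integral_real_affine[where c = "sqrt 2" and t = 0]) simp_all
  also have "(LINT t|lborel. std_normal_density (sqrt 2 * t) * g t) =
      (LINT t|lborel. 1 / sqrt (2 * pi) * (g t * exp (- t\<^sup>2)))"
    by (intro Bochner_Integration.integral_cong) (auto simp: std_normal_density_def power_mult_distrib)
  also have "\<dots> = 1 / sqrt (2 * pi) * (LINT t|lborel. g t * exp (- t\<^sup>2))"
    by (rule integral_mult_right_zero)
  finally show ?thesis by (simp add: real_sqrt_mult)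
qed

lemma normal_half_variance_no_atoms: "emeasure normal_half_variance {c} = 0"
proof -
  have "{sqrt 2 * c} \<in> null_sets std_normal_distribution"
    by (intro absolutely_continuousI_density[THEN absolutely_continuous_def[THEN iffD1], THEN subsetD])
      (simp_all add: finite_imp_null_set_lborel)
  moreover have "(\<lambda>t. t / sqrt 2) -` {c} = {sqrt 2 * c}" by (auto simp: field_simps)
  ultimately show ?thesis
    unfolding normal_half_variance_def by (subst emeasure_distr) (auto simp: null_sets_def)
qed

lemma integrable_normal_half_variance_moment: "integrable normal_half_variance (\<lambda>t. \<bar>t\<bar> ^ p)"
proof -
  have "integrable std_normal_distribution (\<lambda>t. \<bar>t\<bar> ^ p)"
    using integrable_std_normal_moment_abs[of p] by (subst integrable_density) simp_all
  hence "integrable std_normal_distribution (\<lambda>t. \<bar>t\<bar> ^ p / sqrt 2 ^ p)" by simp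
  thus ?thesis
    unfolding normal_half_variance_def by (subst integrable_distr_eq) (simp_all add: power_divide)
qed

lemma even_binomial_truncated_moments:
  assumes a: "a \<longlonglongrightarrow> 0"
  shows "(\<lambda>N. LINT t|even_binomial N (a N). indicator {r..} t * t ^ p) \<longlonglongrightarrow>
    (LINT t|lborel. indicator {r..} t * t ^ p * exp (- t\<^sup>2)) / sqrt pi"
proof -
  obtain C where C: "\<And>N. (LINT t|even_binomial N (a N). \<bar>t\<bar> ^ Suc p) \<le> C"
    using even_binomial_moments_bounded[OF a, of "Suc p"] by blast
  have "(\<lambda>N. LINT t|even_binomial (Suc N) (a (Suc N)). indicator {r..} t * t ^ p) \<longlonglongrightarrow>
      (LINT t|normal_half_variance. indicator {r..} t * t ^ p)"
  proof (rule weak_conv_moment_convergence[where p = p and C = C and r = r])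
    show "isCont (\<lambda>t. indicator {r..} t * t ^ p) t" if "t \<noteq> r" for t
    proof -
      have "isCont (indicator {r..} :: real \<Rightarrow> real) t"
        using that by (simp add: isCont_indicator frontier_def)
      thus ?thesis by (intro continuous_intros)
    qed
    show "\<bar>indicator {r..} t * t ^ p\<bar> \<le> \<bar>t\<bar> ^ p" for t
      by (simp add: indicator_def power_abs)
  qed (auto intro: real_distribution_even_binomial real_distribution_normal_half_variance
      even_binomial_weak_conv a integrable_even_binomial integrable_normal_half_variance_moment
      normal_half_variance_no_atoms C simp del: power_Suc)
  hence "(\<lambda>N. LINT t|even_binomial N (a N). indicator {r..} t * t ^ p) \<longlonglongrightarrow>
      (LINT t|normal_half_variance. indicator {r..} t * t ^ p)"
    by (rule LIMSEQ_imp_Suc)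
  thus ?thesis by (subst (asm) integral_normal_half_variance) simp_all
qed

section \<open>The undeformed kernel\<close>
lemma poly_kraw_rescaled:
  assumes N: "N > 0"
  shows "poly (kraw (2 * N) x) (sqrt (real N) * (t - a)) = sqrt (real N) ^ x * poly (scaled_kraw N a x) t"
proof (induction x rule: induct_nat_012)
  case (ge2 k)
  define w where "w = sqrt (real N)"
  have w2: "w * w = real N" by (simp add: w_def)
  let ?K = "\<lambda>k. poly (kraw (2 * N) k) (w * (t - a))" and ?S = "\<lambda>k. poly (scaled_kraw N a k) t"
  have "2 * real N - real k = w * w * (2 - real k / real N)"
    using N unfolding w2 by (simp add: field_simps)
  hence "real (k + 2) * ?K (Suc (Suc k)) = 2 * (w * (t - a)) * ?K (Suc k) - w * w * (2 - real k / real N) * ?K k"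
    by simp
  also have "\<dots> = w ^ Suc (Suc k) * (2 * (t - a) * ?S (Suc k) - (2 - real k / real N) * ?S k)"
    using ge2 unfolding w_def[symmetric] by (simp add: algebra_simps)
  also have "2 * (t - a) * ?S (Suc k) - (2 - real k / real N) * ?S k = real (k + 2) * ?S (Suc (Suc k))"
  proof -
    have "q * (1 / q * z) = z" if "q > 0" for q z :: real using that by simp
    thus ?thesis unfolding scaled_kraw.simps poly_smult poly_diff poly_mult
      by (simp add: algebra_simps del: of_nat_add of_nat_Suc)
  qed
  finally have "real (k + 2) * ?K (Suc (Suc k)) = real (k + 2) * (w ^ Suc (Suc k) * ?S (Suc (Suc k)))"
    by (simp only: mult.left_commute)
  thus ?case unfolding w_def[symmetric] by (simp del: kraw.simps scaled_kraw.simps of_nat_add of_nat_Suc)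
qed (simp_all add: algebra_simps)

lemma kraw_val_even_point:
  assumes "N > 0"
  shows "kraw_val (2 * N) x (2 * l) = sqrt (real N) ^ x * poly (scaled_kraw N a x) (even_point N a l)"
proof -
  have "sqrt (real N) * (even_point N a l - a) = real (2 * N) / 2 - real (2 * l)"
    using assms by (simp add: even_point_def)
  thus ?thesis using poly_kraw_rescaled[OF assms, of x "even_point N a l" a] by metis
qed

text \<open>
  The numerator \<open>2 * n - 1 - N\<close> in the shift \<open>a\<close> places the cut-off \<open>r\<close> halfway between the points with
  \<open>l = n - 1\<close> and \<open>l = n\<close>, so that the condition \<open>l < n\<close> becomes integration over \<open>[r, \<infinity>)\<close>.
\<close>
lemma kr_kernel_0_eq_integral:
  assumes n: "n \<le> N" and N: "x < N" "y < N" and a: "a = r + (2 * real n - 1 - real N) / sqrt (real N)"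
  shows "kr_kernel 0 N n (int N - int x) (int N - int y) =
    sqrt (real N) ^ (x + y) / sqrt (real (2 * N choose x) * real (2 * N choose y)) *
    (LINT t|even_binomial N a. indicator {r..} t * poly (scaled_kraw N a x * scaled_kraw N a y) t)"
proof -
  define C where "C = sqrt (real (2 * N choose x) * real (2 * N choose y))"
  define P where "P = scaled_kraw N a x * scaled_kraw N a y"
  have N0: "N > 0" using N by simp
  have step: "even_point N a l \<ge> r \<longleftrightarrow> l < n" for l
  proof -
    have "even_point N a l - r = (2 * real n - 2 * real l - 1) / sqrt (real N)"
      by (simp add: even_point_def a add_divide_distrib[symmetric])
    hence "even_point N a l \<ge> r \<longleftrightarrow> 0 \<le> (2 * real n - 2 * real l - 1) / sqrt (real N)" by linarith
    also have "\<dots> \<longleftrightarrow> 2 * l + 1 \<le> 2 * n" using N0 by (simp add: zero_le_divide_iff) linarith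
    also have "\<dots> \<longleftrightarrow> l < n" by linarith
    finally show ?thesis .
  qed
  have "kr_kernel 0 N n (int N - int x) (int N - int y) =
      (\<Sum>l<n. 2 * (kr_fun 0 N (2 * l) (int N - int x) * kr_fun 0 N (2 * l) (int N - int y)))"
    using N by (simp add: kr_kernel_def eta_def sum_distrib_left)
  also have "\<dots> = (\<Sum>l<n. sqrt (real N) ^ (x + y) / C * (even_mass N l * poly P (even_point N a l)))"
  proof (rule sum.cong[OF refl])
    fix l assume "l \<in> {..<n}"
    hence "2 * l \<le> 2 * N" using n by simp
    thus "2 * (kr_fun 0 N (2 * l) (int N - int x) * kr_fun 0 N (2 * l) (int N - int y)) =
      sqrt (real N) ^ (x + y) / C * (even_mass N l * poly P (even_point N a l))"
      using N by (subst kr_fun_0_product)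
        (simp_all only: kraw_val_even_point[OF N0, where a = a], simp_all add: C_def P_def even_mass_def power_add mult_ac)
  qed
  also have "\<dots> = sqrt (real N) ^ (x + y) / C *
      (\<Sum>l\<le>N. even_mass N l *\<^sub>R (indicator {r..} (even_point N a l) * poly P (even_point N a l)))"
    unfolding sum_distrib_left using n
    by (intro sum.mono_neutral_cong_left) (auto simp: step indicator_def)
  also have "(\<Sum>l\<le>N. even_mass N l *\<^sub>R (indicator {r..} (even_point N a l) * poly P (even_point N a l))) =
      (LINT t|even_binomial N a. indicator {r..} t * poly P t)"
    by (rule integral_even_binomial[symmetric]) (intro borel_measurable_times borel_measurable_indicator
        borel_measurable_continuous_onI continuous_intros, simp)
  finally show ?thesis by (simp add: C_def P_def)
qed

lemma poly_eq_sum_coeff: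
  fixes p :: "real poly"
  assumes "degree p \<le> D" shows "poly p t = (\<Sum>i\<le>D. coeff p i * t ^ i)"
proof -
  have "poly p t = poly (\<Sum>i\<le>D. monom (coeff p i) i) t"
    by (simp add: poly_as_sum_of_monoms'[OF assms])
  thus ?thesis by (simp add: poly_sum poly_monom)
qed

lemma truncated_integral_poly:
  fixes M :: "real measure"
  assumes "degree p \<le> D" and "\<And>i. integrable M (\<lambda>t. indicator {r..} t * t ^ i * w t)"
  shows "(LINT t|M. indicator {r..} t * poly p t * w t) =
    (\<Sum>i\<le>D. coeff p i * (LINT t|M. indicator {r..} t * t ^ i * w t))"
proof -
  have "(LINT t|M. indicator {r..} t * poly p t * w t) =
      (LINT t|M. (\<Sum>i\<le>D. coeff p i * (indicator {r..} t * t ^ i * w t)))"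
    by (simp only: poly_eq_sum_coeff[OF assms(1)] sum_distrib_left sum_distrib_right) (simp add: mult_ac)
  also have "\<dots> = (\<Sum>i\<le>D. coeff p i * (LINT t|M. indicator {r..} t * t ^ i * w t))"
    by (subst Bochner_Integration.integral_sum) (auto intro: assms(2) integrable_mult_right)
  finally show ?thesis .
qed

lemma dHe_kernel_eq:
  "dHe_kernel r x y = sqrt (fact x * fact y / 2 ^ (x + y)) *
    (\<Sum>i\<le>x + y. coeff (smult (1 / fact x) (hermite x) * smult (1 / fact y) (hermite y)) i *
       ((LINT t|lborel. indicator {r..} t * t ^ i * exp (- t\<^sup>2)) / sqrt pi))"
proof -
  let ?p = "smult (1 / fact x) (hermite x) * smult (1 / fact y) (hermite y)"
  let ?J = "LINT t|lborel. indicator {r..} t * poly (hermite x * hermite y) t * exp (- t\<^sup>2)"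
  have int: "integrable lborel (\<lambda>t::real. indicator {r..} t * t ^ i * exp (- t\<^sup>2))" for i
    by (rule Bochner_Integration.integrable_bound[OF integrable_gauss_poly[of "monom 1 i"]])
      (auto intro!: AE_I2 simp: indicator_def poly_monom)
  have deg: "degree ?p \<le> x + y"
    by (rule order_trans[OF degree_mult_le]) (simp add: hermite_eq_hermite_rec degree_hermite_rec)
  have "(\<Sum>i\<le>x + y. coeff ?p i * ((LINT t|lborel. indicator {r..} t * t ^ i * exp (- t\<^sup>2)) / sqrt pi)) =
      (LINT t|lborel. indicator {r..} t * poly ?p t * exp (- t\<^sup>2)) / sqrt pi"
    unfolding truncated_integral_poly[OF deg int] by (simp add: sum_divide_distrib)
  also have "(LINT t|lborel. indicator {r..} t * poly ?p t * exp (- t\<^sup>2)) =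
      (LINT t|lborel. 1 / (fact x * fact y) * (indicator {r..} t * poly (hermite x * hermite y) t * exp (- t\<^sup>2)))"
    by (intro Bochner_Integration.integral_cong) (simp_all add: mult_ac)
  also have "\<dots> = 1 / (fact x * fact y) * ?J" by (rule integral_mult_right_zero)
  finally have S: "(\<Sum>i\<le>x + y. coeff ?p i *
      ((LINT t|lborel. indicator {r..} t * t ^ i * exp (- t\<^sup>2)) / sqrt pi)) = 1 / (fact x * fact y) * ?J / sqrt pi" .
  have "(pi * 2 ^ (x + y) * fact x * fact y) powr (- 1 / 2) = 1 / sqrt (pi * 2 ^ (x + y) * fact x * fact y)"
    by (simp add: powr_minus powr_half_sqrt inverse_eq_divide)
  also have "\<dots> = sqrt (fact x * fact y / 2 ^ (x + y)) * (1 / (fact x * fact y) / sqrt pi)"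
  proof -
    have "sqrt (fact x * fact y) * sqrt (fact x * fact y) = (fact x * fact y :: real)" by simp
    thus ?thesis unfolding mult.assoc real_sqrt_mult[of pi] real_sqrt_mult[of "2 ^ (x + y)"] real_sqrt_divide
      by (simp add: divide_simps mult.assoc del: real_sqrt_mult_self)
  qed
  finally have pw: "(pi * 2 ^ (x + y) * fact x * fact y) powr (- 1 / 2) =
      sqrt (fact x * fact y / 2 ^ (x + y)) * (1 / (fact x * fact y) / sqrt pi)" .
  have "(LINT t:{r..}|lborel. poly (hermite x) t * poly (hermite y) t * exp (- t\<^sup>2)) = ?J"
    by (simp add: set_lebesgue_integral_def mult.assoc)
  thus ?thesis unfolding dHe_kernel_def pw S by simp
qed

text \<open>
  The integrand is a polynomial of bounded degree with convergent coefficients, so the limit follows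
  from that of the truncated moments; the binomial coefficients in front supply the normalisation of
  the Hermite functions.
\<close>
lemma kernel_0_limit:
  assumes a: "(\<lambda>N. r + (2 * real (n N) - 1 - real N) / sqrt (real N)) \<longlonglongrightarrow> 0"
    and n: "\<forall>\<^sub>F N in sequentially. n N \<le> N"
  shows "(\<lambda>N. kr_kernel 0 N (n N) (int N - int x) (int N - int y)) \<longlonglongrightarrow> dHe_kernel r x y"
proof -
  define a where "a N = r + (2 * real (n N) - 1 - real N) / sqrt (real N)" for N
  have a0: "a \<longlonglongrightarrow> 0" using a unfolding a_def[abs_def] .
  define P where "P N = scaled_kraw N (a N) x * scaled_kraw N (a N) y" for N
  define m where "m N i = (LINT t|even_binomial N (a N). indicator {r..} t * t ^ i)" for N i
  define c where "c N = sqrt (real N) ^ (x + y) / sqrt (real (2 * N choose x) * real (2 * N choose y))" for N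
  have degP: "degree (P N) \<le> x + y" for N
    unfolding P_def by (intro order_trans[OF degree_mult_le] add_mono degree_scaled_kraw)
  have P: "(\<lambda>N. coeff (P N) i) \<longlonglongrightarrow> coeff (smult (1 / fact x) (hermite x) * smult (1 / fact y) (hermite y)) i" for i
    unfolding P_def coeff_mult by (intro tendsto_intros scaled_kraw_tendsto_hermite a0)
  have m: "(\<lambda>N. m N i) \<longlonglongrightarrow> (LINT t|lborel. indicator {r..} t * t ^ i * exp (- t\<^sup>2)) / sqrt pi" for i
    unfolding m_def by (rule even_binomial_truncated_moments[OF a0])
  have c: "c \<longlonglongrightarrow> sqrt (fact x * fact y / 2 ^ (x + y))"
  proof -
    have eq: "c N = 1 / sqrt (real (2 * N choose x) / real N ^ x * (real (2 * N choose y) / real N ^ y))" for N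
      by (simp add: c_def power_add real_sqrt_mult real_sqrt_divide real_sqrt_power)
    have "c \<longlonglongrightarrow> 1 / sqrt (2 ^ x / fact x * (2 ^ y / fact y))"
      unfolding eq by (intro tendsto_intros binomial_scaling_limit) simp
    also have "1 / sqrt (2 ^ x / fact x * (2 ^ y / fact y)) = sqrt (fact x * fact y / 2 ^ (x + y))"
      by (simp add: power_add real_sqrt_divide real_sqrt_mult)
    finally show ?thesis .
  qed
  have "\<forall>\<^sub>F N in sequentially. c N * (\<Sum>i\<le>x + y. coeff (P N) i * m N i)
      = kr_kernel 0 N (n N) (int N - int x) (int N - int y)"
    using n eventually_gt_at_top[of x] eventually_gt_at_top[of y]
  proof eventually_elim
    case (elim N)
    have "(LINT t|even_binomial N (a N). indicator {r..} t * poly (P N) t * 1) =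
        (\<Sum>i\<le>x + y. coeff (P N) i * (LINT t|even_binomial N (a N). indicator {r..} t * t ^ i * 1))"
      by (rule truncated_integral_poly[OF degP]) (rule integrable_even_binomial, measurable)
    thus ?case
      using kr_kernel_0_eq_integral[OF elim, of "a N" r] by (simp add: a_def c_def P_def m_def)
  qed
  moreover have "(\<lambda>N. c N * (\<Sum>i\<le>x + y. coeff (P N) i * m N i)) \<longlonglongrightarrow> dHe_kernel r x y"
    unfolding dHe_kernel_eq by (intro tendsto_intros c P m)
  ultimately show ?thesis by (rule Lim_transform_eventually[rotated])
qed

lemma kr_form_0_limit:
  assumes a: "(\<lambda>N. r + (2 * real (n N) - 1 - real N) / sqrt (real N)) \<longlonglongrightarrow> 0"
    and n: "\<forall>\<^sub>F N in sequentially. n N \<le> N"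
    and c: "c1 \<longlonglongrightarrow> C1" "c2 \<longlonglongrightarrow> C2"
  shows "(\<lambda>N. 2 * kr_form 0 N (n N) (int N - int x) (int N - int y) (c1 N) (c2 N)) \<longlonglongrightarrow>
    C1\<^sup>2 * dHe_kernel r x x + 2 * C1 * C2 * dHe_kernel r x y + C2\<^sup>2 * dHe_kernel r y y"
proof -
  let ?K = "\<lambda>x y N. kr_kernel 0 N (n N) (int N - int x) (int N - int y)"
  have "(\<lambda>N. (c1 N)\<^sup>2 * ?K x x N + 2 * c1 N * c2 N * ?K x y N + (c2 N)\<^sup>2 * ?K y y N) \<longlonglongrightarrow>
      C1\<^sup>2 * dHe_kernel r x x + 2 * C1 * C2 * dHe_kernel r x y + C2\<^sup>2 * dHe_kernel r y y"
    by (intro tendsto_intros c kernel_0_limit[OF a n])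
  moreover have "\<forall>\<^sub>F N in sequentially. (c1 N)\<^sup>2 * ?K x x N + 2 * c1 N * c2 N * ?K x y N + (c2 N)\<^sup>2 * ?K y y N
      = 2 * kr_form 0 N (n N) (int N - int x) (int N - int y) (c1 N) (c2 N)"
    using eventually_gt_at_top[of x] eventually_gt_at_top[of y]
  proof eventually_elim
    case (elim N)
    thus ?case
      unfolding kr_form_def sum_bilinear_quadratic by (simp add: kr_kernel_def eta_def algebra_simps)
  qed
  ultimately show ?thesis by (rule Lim_transform_eventually)
qed

section \<open>The limit of the deformed kernels\<close>
theorem proposition4p3:
  fixes r :: real and n :: "nat \<Rightarrow> nat" and d x y :: nat
  assumes "\<And>N. n N > 0"
    and "(\<lambda>N. real (n N) / real N - (1 / 2 - r / (2 * sqrt (real N))))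
           \<in> o(\<lambda>N. real N powr (- 1 / 2))"
  shows "(\<lambda>N. kr_kernel d N (n N) (int N - int x) (int N - int y)) \<longlonglongrightarrow> dHe_kernel r x y"
proof -
  define e where "e N = real (n N) / real N - (1 / 2 - r / (2 * sqrt (real N)))" for N
  have e: "(\<lambda>N. e N / real N powr (- 1 / 2)) \<longlonglongrightarrow> 0"
    using smalloD_tendsto[OF assms(2)] by (simp add: e_def)
  \<comment> \<open>The hypothesis on \<open>n\<close> is insensitive to bounded shifts, such as the \<open>d\<close> additional degrees of the
     upper bound.\<close>
  have a: "(\<lambda>N. r + (2 * real (n N + k) - 1 - real N) / sqrt (real N)) \<longlonglongrightarrow> 0" for k
  proof -
    have "(\<lambda>N. (2 * real k - 1) / sqrt (real N)) \<longlonglongrightarrow> 0" by real_asymp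
    hence "(\<lambda>N. 2 * (e N / real N powr (- 1 / 2)) + (2 * real k - 1) / sqrt (real N)) \<longlonglongrightarrow> 2 * 0 + 0"
      by (intro tendsto_intros e)
    moreover have "\<forall>\<^sub>F N in sequentially. 2 * (e N / real N powr (- 1 / 2)) + (2 * real k - 1) / sqrt (real N)
        = r + (2 * real (n N + k) - 1 - real N) / sqrt (real N)"
      using eventually_gt_at_top[of 0]
    proof eventually_elim
      case (elim N)
      define w where "w = sqrt (real N)"
      have w: "w > 0" "real N = w * w" using elim by (auto simp: w_def)
      have pw: "real N powr (- 1 / 2) = 1 / w"
        using elim by (simp add: w_def powr_minus powr_half_sqrt inverse_eq_divide)
      show ?case
        unfolding e_def pw w_def[symmetric] unfolding w(2) using w(1) by (simp add: field_simps)
    qed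
    ultimately show ?thesis by (simp add: Lim_transform_eventually)
  qed
  have n: "\<forall>\<^sub>F N in sequentially. n N + k \<le> N" for k
  proof -
    have "\<forall>\<^sub>F N in sequentially. (1 - r) * sqrt (real N) \<le> real N - 1" by real_asymp
    moreover have "\<forall>\<^sub>F N in sequentially. r + (2 * real (n N + k) - 1 - real N) / sqrt (real N) < 1"
      by (rule order_tendstoD(2)[OF a]) simp
    ultimately show ?thesis
      using eventually_gt_at_top[of 0]
    proof eventually_elim
      case (elim N)
      have "(2 * real (n N + k) - 1 - real N) / sqrt (real N) < 1 - r" using elim(2) by simp
      hence "2 * real (n N + k) - 1 - real N < (1 - r) * sqrt (real N)"
        using elim(3) by (simp add: divide_less_eq)
      with elim(1) show ?case by simp
    qed
  qed
  show ?thesis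
  proof (cases "d = 0")
    case True
    thus ?thesis using kernel_0_limit[of r n] a[of 0] n[of 0] by simp
  next
    case False
    let ?X = "\<lambda>N. int N - int x" and ?Y = "\<lambda>N. int N - int y"
    define A where "A N = (of_int (?X N) / real N) ^ d" for N
    define B where "B N = (of_int (?Y N) / real N) ^ d" for N
    have one: "(\<lambda>N. (of_int (int N - int z) / real N) ^ d) \<longlonglongrightarrow> 1" for z :: nat
    proof -
      have "(\<lambda>N. (of_int (int N - int z) / real N)) \<longlonglongrightarrow> 1" by simp real_asymp
      from tendsto_power[OF this, of d] show ?thesis by simp
    qed
    have A: "A \<longlonglongrightarrow> 1" and B: "B \<longlonglongrightarrow> 1" unfolding A_def B_def by (rule one)+
    define L where "L c1 c2 = c1\<^sup>2 * dHe_kernel r x x + 2 * c1 * c2 * dHe_kernel r x y + c2\<^sup>2 * dHe_kernel r y y" for c1 c2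
    \<comment> \<open>The two comparisons enclose the form of the deformed kernel between undeformed ones whose
       arguments differ by the factors \<open>A\<close> and \<open>B\<close>.\<close>
    have form: "(\<lambda>N. 2 * kr_form d N (n N) (?X N) (?Y N) c1 c2) \<longlonglongrightarrow> L c1 c2" for c1 c2
    proof (rule tendsto_sandwich)
      show "\<forall>\<^sub>F N in sequentially. 2 * kr_form 0 N (n N) (?X N) (?Y N) (c1 * A N) (c2 * B N)
          \<le> 2 * kr_form d N (n N) (?X N) (?Y N) c1 c2"
        using n[of 0] eventually_gt_at_top[of x] eventually_gt_at_top[of y]
      proof eventually_elim
        case (elim N)
        show ?case unfolding A_def B_def mult_le_cancel_left_pos[OF zero_less_numeral]
          by (rule kr_form_deform_lower) (use elim in \<open>auto simp: kr_space_def\<close>)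
      qed
      show "\<forall>\<^sub>F N in sequentially. 2 * kr_form d N (n N) (?X N) (?Y N) c1 c2
          \<le> 2 * kr_form 0 N (n N + d) (?X N) (?Y N) (c1 / A N) (c2 / B N)"
        using n[of d] eventually_gt_at_top[of x] eventually_gt_at_top[of y]
      proof eventually_elim
        case (elim N)
        have nz: "A N \<noteq> 0" "B N \<noteq> 0" using elim by (auto simp: A_def B_def)
        have "kr_form d N (n N) (?X N) (?Y N) (c1 / A N * A N) (c2 / B N * B N)
            \<le> kr_form 0 N (n N + d) (?X N) (?Y N) (c1 / A N) (c2 / B N)"
          unfolding A_def B_def by (rule kr_form_deform_upper) (use elim in \<open>auto simp: kr_space_def\<close>)
        thus ?case using nz by simp
      qed
      have "(\<lambda>N. c1 * A N) \<longlonglongrightarrow> c1 * 1" "(\<lambda>N. c2 * B N) \<longlonglongrightarrow> c2 * 1"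
        by (intro tendsto_intros A B)+
      thus "(\<lambda>N. 2 * kr_form 0 N (n N) (?X N) (?Y N) (c1 * A N) (c2 * B N)) \<longlonglongrightarrow> L c1 c2"
        unfolding L_def using a[of 0] n[of 0] by (intro kr_form_0_limit) simp_all
      have "(\<lambda>N. c1 / A N) \<longlonglongrightarrow> c1 / 1" "(\<lambda>N. c2 / B N) \<longlonglongrightarrow> c2 / 1"
        by (intro tendsto_intros A B; simp)+
      thus "(\<lambda>N. 2 * kr_form 0 N (n N + d) (?X N) (?Y N) (c1 / A N) (c2 / B N)) \<longlonglongrightarrow> L c1 c2"
        unfolding L_def using a[of d] n[of d] by (intro kr_form_0_limit) simp_all
    qed
    have "(\<lambda>N. (2 * kr_form d N (n N) (?X N) (?Y N) 1 1 - 2 * kr_form d N (n N) (?X N) (?Y N) 1 (- 1)) / 4)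
        \<longlonglongrightarrow> (L 1 1 - L 1 (- 1)) / 4"
      by (intro tendsto_intros form) simp
    moreover have "(2 * kr_form d N (n N) (?X N) (?Y N) 1 1 - 2 * kr_form d N (n N) (?X N) (?Y N) 1 (- 1)) / 4
        = kr_kernel d N (n N) (?X N) (?Y N)" for N
      using False unfolding kr_form_def sum_bilinear_quadratic by (simp add: kr_kernel_def)
    moreover have "(L 1 1 - L 1 (- 1)) / 4 = dHe_kernel r x y" by (simp add: L_def)
    ultimately show ?thesis by simp
  qed
qed

end
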